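(* Fix $M>0$. The function $H:\mathbb{R}\times[0,+\infty)\to\mathbb{C}$ given by $$H(x,t)=\int_{-\infty}^{+\infty}e^{-t\lambda^2}e^{ix\lambda}f(\lambda)\,d\lambda,$$ where $$f(\lambda)=\frac{1}{2\pi i}\int_{\gamma_M}e^{e^{-\zeta^2}}e^{\zeta\lambda}\,d\zeta,$$ is a non-trivial (i.e. not identically zero) nulltemperature function.
   Context: Contour: write $\zeta=\sigma+i\tau$ with $\sigma,\tau\in\mathbb{R}$. For $M>0$, $\gamma_M$ is the contour $$\gamma_M=\left\{\zeta\in\mathbb{C}:|\sigma|=\frac{\pi}{2\tau},\ \tau\ge M\right\}\cup\left\{\zeta\in\mathbb{C}:\tau=M,\ |\sigma|\le\frac{\pi}{2M}\right\},$$ oriented clockwise: it comes down from $+i\infty$ along the right branch $\sigma=\frac{\pi}{2\tau}$, runs along the segment $\tau=M$ from right to left, and goes up to $+i\infty$ along the left branch $\sigma=-\frac{\pi}{2\tau}$. The value $f(\lambda)$ does not depend on the choice of $M>0$. Nulltemperature function: a smooth function $H:\mathbb{R}\times[0,+\infty)\to\mathbb{C}$ of the real variables $(x,t)$ is a nulltemperature function if it solves the Cauchy initial value problem for the complex heat equation $$\frac{\partial H}{\partial t}=\frac{\partial^2H}{\partial x^2},\qquad H(x,0)=0.$$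
   Formalization: At t = 0 the integral defining H(x,0) does not converge absolutely (otherwise f, hence H, would vanish), so H(x,0) is defined as the limit of H(x,t) as t → 0+; this limit is proved to exist and to be 0. *)

theory Defs
  imports "HOL-Complex_Analysis.Complex_Analysis"
begin

text \<open>
  Derivatives are taken within \<open>S\<close>. We only use \<open>S = UNIV \<times> {0..}\<close>, where they are unique and are
  one-sided in the second variable at boundary points; \<open>a\<close> and \<open>b\<close> are the two partial derivatives.
\<close>

fun Ck_on :: "nat \<Rightarrow> (real \<times> real) set \<Rightarrow> (real \<times> real \<Rightarrow> complex) \<Rightarrow> bool" where
  "Ck_on 0 S u \<longleftrightarrow> continuous_on S u"
| "Ck_on (Suc k) S u \<longleftrightarrow>
     (\<exists>a b. Ck_on k S a \<and> Ck_on k S b \<and>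
        (\<forall>p\<in>S. (u has_derivative (\<lambda>(h, s). h *\<^sub>R a p + s *\<^sub>R b p)) (at p within S)))"

definition smooth_on :: "(real \<times> real) set \<Rightarrow> (real \<times> real \<Rightarrow> complex) \<Rightarrow> bool" where
  "smooth_on S u \<longleftrightarrow> (\<forall>k. Ck_on k S u)"

text \<open>
  The first argument of \<open>H\<close> is the space variable, the second one is time; only times \<open>t \<ge> 0\<close> matter.
\<close>

definition nulltemperature :: "(real \<Rightarrow> real \<Rightarrow> complex) \<Rightarrow> bool" where
  "nulltemperature H \<longleftrightarrow>
     smooth_on (UNIV \<times> {0..}) (\<lambda>(x, t). H x t) \<and>
     (\<forall>x. \<forall>t\<ge>0. vector_derivative (\<lambda>s. H x s) (at t within {0..}) =
                 vector_derivative (\<lambda>y. vector_derivative (\<lambda>z. H z t) (at y)) (at x)) \<and>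
     (\<forall>x. H x 0 = 0)"

definition right_branch :: "real \<Rightarrow> complex" where
  "right_branch \<tau> = Complex (pi / (2 * \<tau>)) \<tau>"

definition left_branch :: "real \<Rightarrow> complex" where
  "left_branch \<tau> = Complex (- pi / (2 * \<tau>)) \<tau>"

text \<open>
  The contour consists of the right branch (traversed downwards, hence the minus sign), the
  horizontal segment at height \<open>M\<close> from right to left, and the left branch traversed upwards.
  Convergence on the infinite branches means absolute convergence.
\<close>

definition gamma_integrable :: "real \<Rightarrow> (complex \<Rightarrow> complex) \<Rightarrow> bool" where
  "gamma_integrable M F \<longleftrightarrow>
     set_integrable lborel {M..}
       (\<lambda>\<tau>. F (right_branch \<tau>) * vector_derivative right_branch (at \<tau>)) \<and>
     F contour_integrable_on linepath (right_branch M) (left_branch M) \<and>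
     set_integrable lborel {M..}
       (\<lambda>\<tau>. F (left_branch \<tau>) * vector_derivative left_branch (at \<tau>))"

definition gamma_integral :: "real \<Rightarrow> (complex \<Rightarrow> complex) \<Rightarrow> complex" where
  "gamma_integral M F =
     - (LBINT \<tau>:{M..}. F (right_branch \<tau>) * vector_derivative right_branch (at \<tau>))
     + contour_integral (linepath (right_branch M) (left_branch M)) F
     + (LBINT \<tau>:{M..}. F (left_branch \<tau>) * vector_derivative left_branch (at \<tau>))"

definition f_integrand :: "real \<Rightarrow> complex \<Rightarrow> complex" where
  "f_integrand l \<zeta> = exp (exp (- (\<zeta>\<^sup>2))) * exp (\<zeta> * of_real l)"

definition f_fun :: "real \<Rightarrow> real \<Rightarrow> complex" where
  "f_fun M l = 1 / (2 * of_real pi * \<i>) * gamma_integral M (f_integrand l)"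

definition H_integrand :: "real \<Rightarrow> real \<Rightarrow> real \<Rightarrow> real \<Rightarrow> complex" where
  "H_integrand M x t l = of_real (exp (- t * l\<^sup>2)) * exp (\<i> * of_real x * of_real l) * f_fun M l"

text \<open>
  For \<open>t = 0\<close> the integral does not converge: \<open>f_fun M\<close> is not Lebesgue integrable (if it were, a
  vanishing initial value would force it to vanish by Fourier inversion). The value at \<open>t = 0\<close> is
  therefore the limit for \<open>t \<rightarrow> 0+\<close>, rather than the default value of a divergent Bochner integral.
\<close>

definition H_fun :: "real \<Rightarrow> real \<Rightarrow> real \<Rightarrow> complex" where
  "H_fun M x t =
     (if t > 0 then LBINT l. H_integrand M x t l
      else Lim (at_right 0) (\<lambda>s. LBINT l. H_integrand M x s l))"

end

theory Submission
  imports Defs "HOL-Probability.Characteristic_Functions"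
begin

text \<open>
  On the two branches of the contour \<open>exp (- \<zeta>\<^sup>2)\<close> is real and negative of size about \<open>exp (\<tau>\<^sup>2)\<close>, so
  \<open>exp (exp (- \<zeta>\<^sup>2))\<close> decays doubly exponentially there. Fubini and the Gaussian integral give, for
  \<open>t > 0\<close>, that \<open>H\<close> is a constant times the contour integral of
  \<open>exp (exp (- \<zeta>\<^sup>2)) * t powr (- 1/2) * exp ((\<zeta> + \<i> * x)\<^sup>2 / (4 * t))\<close>. By Cauchy's theorem the contour may be
  moved up, depending on \<open>x\<close>, until the real part of \<open>(\<zeta> + \<i> * x)\<^sup>2\<close> is at most \<open>- 3\<close>; then the kernel and all its
  derivatives vanish rapidly as \<open>t\<close> tends to 0, uniformly for bounded \<open>x\<close>. This gives smoothness up
  to \<open>t = 0\<close>, the zero initial value, and the heat equation under the integral sign.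

  If \<open>H\<close> vanished for \<open>t = 1/4\<close>, then the integrals of \<open>F \<zeta> * exp (2 * \<i> * \<zeta> * x)\<close> over the contour would vanish for
  all \<open>x\<close>, where \<open>F \<zeta> = exp (exp (- \<zeta>\<^sup>2)) * exp (\<zeta>\<^sup>2)\<close>. Integrating against \<open>exp (2 * v * x)\<close> over
  \<open>x > 0\<close>, the Cauchy integral of \<open>F\<close> at \<open>\<i> * v\<close> over the contour at height \<open>v + 1\<close> vanishes. The one over the contour at
  height 1 then has modulus \<open>2 * pi * norm (F (\<i> * v))\<close>, which is doubly exponential in \<open>v\<close>, although
  it grows at most linearly in \<open>v\<close>.
\<close>

subsection \<open>Preliminaries\<close>

lemma Ck_on_cong:
  assumes "Ck_on k S u" "\<And>p. p \<in> S \<Longrightarrow> u p = v p"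
  shows "Ck_on k S v"
proof (cases k)
  case 0
  with assms show ?thesis by (simp cong: continuous_on_cong)
next
  case (Suc n)
  then obtain a b where ab: "Ck_on n S a" "Ck_on n S b"
    "\<And>p. p \<in> S \<Longrightarrow> (u has_derivative (\<lambda>(h, s). h *\<^sub>R a p + s *\<^sub>R b p)) (at p within S)"
    using assms by auto
  have "(v has_derivative (\<lambda>(h, s). h *\<^sub>R a p + s *\<^sub>R b p)) (at p within S)" if "p \<in> S" for p
    using has_derivative_transform[OF that _ ab(3)[OF that], of v] assms(2) by simp
  with ab(1,2) show ?thesis unfolding Suc Ck_on.simps by blast
qed

lemma Ck_on_add:
  "Ck_on k S u \<Longrightarrow> Ck_on k S v \<Longrightarrow> Ck_on k S (\<lambda>p. u p + v p)"
proof (induction k arbitrary: u v)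
  case 0
  then show ?case by (simp add: continuous_on_add)
next
  case (Suc n)
  obtain a b where ab: "Ck_on n S a" "Ck_on n S b"
    "\<And>p. p \<in> S \<Longrightarrow> (u has_derivative (\<lambda>(h, s). h *\<^sub>R a p + s *\<^sub>R b p)) (at p within S)"
    using Suc.prems by auto
  obtain c d where cd: "Ck_on n S c" "Ck_on n S d"
    "\<And>p. p \<in> S \<Longrightarrow> (v has_derivative (\<lambda>(h, s). h *\<^sub>R c p + s *\<^sub>R d p)) (at p within S)"
    using Suc.prems by auto
  have "((\<lambda>p. u p + v p) has_derivative (\<lambda>(h, s). h *\<^sub>R (a p + c p) + s *\<^sub>R (b p + d p))) (at p within S)"
    if "p \<in> S" for p
    by (rule has_derivative_eq_rhs[OF has_derivative_add[OF ab(3)[OF that] cd(3)[OF that]]])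
      (auto simp: fun_eq_iff algebra_simps)
  with Suc.IH[OF ab(1) cd(1)] Suc.IH[OF ab(2) cd(2)] show ?case unfolding Ck_on.simps by blast
qed

lemma Ck_on_cmult:
  "Ck_on k S u \<Longrightarrow> Ck_on k S (\<lambda>p. c * u p)"
proof (induction k arbitrary: u)
  case 0
  then show ?case by (auto intro: continuous_intros)
next
  case (Suc n)
  obtain a b where ab: "Ck_on n S a" "Ck_on n S b"
    "\<And>p. p \<in> S \<Longrightarrow> (u has_derivative (\<lambda>(h, s). h *\<^sub>R a p + s *\<^sub>R b p)) (at p within S)"
    using Suc.prems by auto
  have "((\<lambda>p. c * u p) has_derivative (\<lambda>(h, s). h *\<^sub>R (c * a p) + s *\<^sub>R (c * b p))) (at p within S)"
    if "p \<in> S" for p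
    by (rule has_derivative_eq_rhs[OF has_derivative_mult_right[OF ab(3)[OF that]]])
      (auto simp: fun_eq_iff algebra_simps)
  with Suc.IH[OF ab(1)] Suc.IH[OF ab(2)] show ?case unfolding Ck_on.simps by blast
qed

text \<open>\<open>Ck_on\<close> asks for total derivatives, so the two variables are treated
  jointly. On a convex set the mean value inequality bounds the increment of \<open>g\<close> by
  \<open>2 * B s\<close> times the distance, the 2 coming from the two partial derivatives. The
  remainder quotients along any sequence tending to \<open>q\<close> are then dominated by
  \<open>4 * B s\<close>, and dominated convergence applies, also at boundary points of
  \<open>S\<close>.\<close>

lemma has_derivative_integral_dominated:
  fixes g :: "real \<times> real \<Rightarrow> real \<Rightarrow> complex"
  assumes S: "convex S" "q \<in> S"
    and der: "\<And>p s. p \<in> S \<Longrightarrow> ((\<lambda>p. g p s) has_derivative (\<lambda>(h, k). h *\<^sub>R a p s + k *\<^sub>R b p s)) (at p within S)"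
    and bd: "\<And>p s. p \<in> S \<Longrightarrow> norm (a p s) \<le> B s" "\<And>p s. p \<in> S \<Longrightarrow> norm (b p s) \<le> B s"
    and int: "\<And>p. p \<in> S \<Longrightarrow> integrable lborel (g p)"
      "integrable lborel (a q)" "integrable lborel (b q)" "integrable lborel B"
  shows "((\<lambda>p. LBINT s. g p s) has_derivative
           (\<lambda>(h, k). h *\<^sub>R (LBINT s. a q s) + k *\<^sub>R (LBINT s. b q s))) (at q within S)"
proof -
  let ?L = "\<lambda>s (h, k). h *\<^sub>R a q s + k *\<^sub>R b q s"
  let ?I = "\<lambda>(h, k). h *\<^sub>R (LBINT s. a q s) + k *\<^sub>R (LBINT s. b q s)"
  have L_bd: "norm (h *\<^sub>R a p s + k *\<^sub>R b p s) \<le> 2 * B s * norm (h, k)" if "p \<in> S" for p h k s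
  proof -
    have "\<bar>h\<bar> \<le> norm (h, k)" "\<bar>k\<bar> \<le> norm (h, k)"
      using norm_fst_le[of h k] norm_snd_le[of k h] by auto
    then have "\<bar>h\<bar> * norm (a p s) + \<bar>k\<bar> * norm (b p s) \<le> norm (h, k) * B s + norm (h, k) * B s"
      by (intro add_mono mult_mono bd that) auto
    then show ?thesis
      by (intro order_trans[OF norm_triangle_ineq]) (simp add: algebra_simps)
  qed
  have lip: "norm (g p s - g q s) \<le> 2 * B s * norm (p - q)" if "p \<in> S" for p s
  proof (rule differentiable_bound[OF S(1) der _ that S(2)])
    show "onorm (\<lambda>(h, k). h *\<^sub>R a p s + k *\<^sub>R b p s) \<le> 2 * B s" if "p \<in> S" for p
      using L_bd[OF that] by (intro onorm_le) auto
  qed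
  have I: "bounded_linear ?I"
    using bounded_linear_add[OF bounded_linear_compose[OF bounded_linear_scaleR_left bounded_linear_fst]
        bounded_linear_compose[OF bounded_linear_scaleR_left bounded_linear_snd], of "LBINT s. a q s" "LBINT s. b q s"]
    by (simp add: case_prod_unfold)
  have "((\<lambda>p. norm ((LBINT s. g p s) - (LBINT s. g q s) - ?I (p - q)) / norm (p - q)) \<longlongrightarrow> 0) (at q within S)"
    unfolding tendsto_at_iff_sequentially
  proof (intro allI impI)
    fix X assume X: "\<forall>i. X i \<in> S - {q}" "X \<longlonglongrightarrow> q"
    let ?r = "\<lambda>n s. (1 / norm (X n - q)) *\<^sub>R (g (X n) s - g q s - ?L s (X n - q))"
    have int1: "integrable lborel (\<lambda>s. ?L s p)" for p
      using int by (auto simp: case_prod_unfold)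
    have int2: "integrable lborel (\<lambda>s. g (X n) s - g q s - ?L s (X n - q))" for n
      using X S int int1 by auto
    have "(\<lambda>n. LBINT s. ?r n s) \<longlonglongrightarrow> (LBINT s::real. 0::complex)"
    proof (rule integral_dominated_convergence)
      show "integrable lborel (\<lambda>s. 4 * B s)" using int by auto
      show "?r n \<in> borel_measurable lborel" for n using int2[of n] by measurable
      show "AE s in lborel. (\<lambda>n. ?r n s) \<longlonglongrightarrow> 0"
      proof (rule AE_I2)
        fix s
        have "((\<lambda>p. norm (g p s - g q s - ?L s (p - q)) / norm (p - q)) \<longlongrightarrow> 0) (at q within S)"
          using der[OF S(2), of s] unfolding has_derivative_iff_norm by simp
        then have "(\<lambda>n. norm (g (X n) s - g q s - ?L s (X n - q)) / norm (X n - q)) \<longlonglongrightarrow> 0"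
          using X unfolding tendsto_at_iff_sequentially by (auto simp: o_def)
        then show "(\<lambda>n. ?r n s) \<longlonglongrightarrow> 0"
          by (subst tendsto_norm_zero_iff[symmetric]) (simp add: divide_inverse mult.commute)
      qed
      show "AE s in lborel. norm (?r n s) \<le> 4 * B s" for n
      proof (rule AE_I2)
        fix s
        have "norm (g (X n) s - g q s - ?L s (X n - q))
            \<le> 2 * B s * norm (X n - q) + 2 * B s * norm (X n - q)"
          using lip[of "X n" s] L_bd[of q "fst (X n - q)" s "snd (X n - q)"] X S
          by (intro order_trans[OF norm_triangle_ineq4 add_mono]) (auto simp: case_prod_unfold minus_prod_def)
        then show "norm (?r n s) \<le> 4 * B s"
          using X(1) by (simp add: divide_simps)
      qed
    qed simp
    moreover have "(LBINT s. ?r n s) =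
        (1 / norm (X n - q)) *\<^sub>R ((LBINT s. g (X n) s) - (LBINT s. g q s) - ?I (X n - q))" for n
    proof -
      have "(LBINT s. ?r n s) = (1 / norm (X n - q)) *\<^sub>R (LBINT s. g (X n) s - g q s - ?L s (X n - q))"
        by (rule integral_scaleR_right)
      also have "(LBINT s. g (X n) s - g q s - ?L s (X n - q)) =
          (LBINT s. g (X n) s) - (LBINT s. g q s) - (LBINT s. ?L s (X n - q))"
        using X S int int1 by simp
      also have "(LBINT s. ?L s (X n - q)) = ?I (X n - q)"
        using int by (simp add: case_prod_unfold)
      finally show ?thesis .
    qed
    ultimately have "(\<lambda>n. (1 / norm (X n - q)) *\<^sub>R ((LBINT s. g (X n) s) - (LBINT s. g q s) - ?I (X n - q))) \<longlonglongrightarrow> 0"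
      by (simp only: Bochner_Integration.integral_zero)
    from tendsto_norm[OF this]
    show "((\<lambda>p. norm ((LBINT s. g p s) - (LBINT s. g q s) - ?I (p - q)) / norm (p - q)) \<circ> X) \<longlonglongrightarrow> 0"
      by (simp add: o_def divide_inverse mult.commute)
  qed
  with I show ?thesis unfolding has_derivative_iff_norm by simp
qed

text \<open>The majorant \<open>A l\<close> does not depend on \<open>s\<close>, so
  \<open>A l * norm (\<phi> s)\<close> is an integrable bound on the product. This serves twice: for
  the Gaussian integral that defines the temperature, and for the half-line integral that produces
  the Cauchy kernel.\<close>

lemma Fubini_dominated:
  fixes \<phi> :: "real \<Rightarrow> complex" and K :: "real \<Rightarrow> real \<Rightarrow> complex"
  assumes \<phi>: "integrable lborel \<phi>" and A: "integrable lborel A"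
    and K[measurable]: "case_prod K \<in> borel_measurable (borel \<Otimes>\<^sub>M borel)"
    and bd: "\<And>l s. norm (K l s) \<le> A l"
  shows "integrable lborel (\<lambda>l. LBINT s. \<phi> s * K l s)"
    and "(LBINT l. LBINT s. \<phi> s * K l s) = (LBINT s. \<phi> s * (LBINT l. K l s))"
proof -
  have [measurable]: "\<phi> \<in> borel_measurable borel" "A \<in> borel_measurable borel"
    using \<phi> A by (auto dest: borel_measurable_integrable)
  have "integrable (lborel \<Otimes>\<^sub>M lborel) (\<lambda>p. A (fst p) * norm (\<phi> (snd p)))"
  proof (rule lborel_pair.Fubini_integrable)
    have "integrable lborel (\<lambda>x. norm (A x) * (LBINT y. norm (\<phi> y)))"
      using A by (intro integrable_mult_left integrable_norm) auto
    then show "integrable lborel (\<lambda>x. LBINT y. norm (A (fst (x, y)) * norm (\<phi> (snd (x, y)))))"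
      by (simp add: abs_mult)
  qed (use \<phi> in \<open>auto\<close>)
  then have *: "integrable (lborel \<Otimes>\<^sub>M lborel) (\<lambda>(l, s). \<phi> s * K l s)"
  proof (rule Bochner_Integration.integrable_bound)
    have "norm (\<phi> s * K l s) \<le> norm (A l * norm (\<phi> s))" for l s
      using mult_right_mono[OF bd[of l s], of "norm (\<phi> s)"] order_trans[OF norm_ge_zero bd[of l s]]
      by (simp add: norm_mult abs_mult mult.commute)
    then show "AE p in lborel \<Otimes>\<^sub>M lborel. norm (case p of (l, s) \<Rightarrow> \<phi> s * K l s) \<le> norm (A (fst p) * norm (\<phi> (snd p)))"
      by (intro AE_I2) auto
  qed measurable
  from lborel_pair.integrable_fst'[OF *] show "integrable lborel (\<lambda>l. LBINT s. \<phi> s * K l s)" by simp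
  from lborel_pair.Fubini_integral[OF *]
  show "(LBINT l. LBINT s. \<phi> s * K l s) = (LBINT s. \<phi> s * (LBINT l. K l s))" by simp
qed

lemma integrable_gauss: "c > 0 \<Longrightarrow> integrable lborel (\<lambda>x::real. exp (- c * x\<^sup>2))"
proof -
  assume c: "c > 0"
  have "integrable lborel (\<lambda>x. sqrt (2 * pi) * std_normal_density (0 + sqrt (2 * c) * x))"
    using c by (intro integrable_mult_right lborel_integrable_real_affine integrable_normal_density) auto
  then show ?thesis
    using c by (simp add: std_normal_density_def power_mult_distrib)
qed

text \<open>The argument stays on the real line. Completing the square for \<open>Re z\<close> only
  leaves \<open>Im z\<close> as a frequency, so the integral becomes the characteristic function of
  the standard normal distribution. The scale \<open>c\<close> satisfies
  \<open>t * c\<^sup>2 = 1 / 2\<close>, which normalises the quadratic term to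
  \<open>v\<^sup>2 / 2\<close>.\<close>

lemma integral_complex_gauss:
  fixes t :: real and z :: complex
  assumes t: "t > 0"
  shows "(LBINT l. exp (- of_real (t * l\<^sup>2) + z * of_real l)) =
           of_real (sqrt pi) * (of_real (t powr (-1/2)) * exp (z\<^sup>2 / of_real (4 * t)))"
proof -
  define c where "c = 1 / sqrt (2 * t)"
  have c: "c > 0" "c\<^sup>2 = 1 / (2 * t)" using t by (auto simp: c_def power_divide)
  have *: "- of_real (t * (Re z / (2 * t) + c * v)\<^sup>2) + z * of_real (Re z / (2 * t) + c * v) =
      (of_real ((Re z)\<^sup>2 / (4 * t)) + \<i> * of_real (Re z * Im z / (2 * t)))
       + (of_real (- v\<^sup>2 / 2) + \<i> * of_real ((Im z * c) * v))" for v
  proof -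
    have "t * c\<^sup>2 = 1 / 2" using t c by simp
    moreover have "t * (a / (2 * t) + c * v)\<^sup>2 = a\<^sup>2 / (4 * t) + a * (c * v) + (t * c\<^sup>2) * v\<^sup>2" for a
      using t by (simp add: power2_eq_square field_simps)
    ultimately have "- (t * (a / (2 * t) + c * v)\<^sup>2) + a * (a / (2 * t) + c * v) = a\<^sup>2 / (4 * t) - v\<^sup>2 / 2" for a
      using t by (simp add: power2_eq_square field_simps)
    from this[of "Re z"] show ?thesis
      by (simp add: complex_eq_iff algebra_simps del: of_real_add of_real_mult of_real_power of_real_divide)
  qed
  have char: "(LBINT v. of_real (exp (- v\<^sup>2 / 2)) * exp (\<i> * of_real (b * v))) = of_real (sqrt (2 * pi)) * of_real (exp (- b\<^sup>2 / 2))" for b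
  proof -
    have "of_real (exp (- b\<^sup>2 / 2)) = char std_normal_distribution b"
      by (simp add: char_std_normal_distribution)
    also have "\<dots> = (LBINT v. std_normal_density v *\<^sub>R iexp (b * v))"
      unfolding char_def by (subst integral_density) auto
    also have "\<dots> = (LBINT v. of_real (1 / sqrt (2 * pi)) * (of_real (exp (- v\<^sup>2 / 2)) * exp (\<i> * of_real (b * v))))"
      by (simp add: std_normal_density_def scaleR_conv_of_real mult.assoc)
    finally show ?thesis by (simp add: real_sqrt_mult)
  qed
  have "(LBINT l. exp (- of_real (t * l\<^sup>2) + z * of_real l)) =
      \<bar>c\<bar> *\<^sub>R (LBINT v. exp (- of_real (t * (Re z / (2 * t) + c * v)\<^sup>2) + z * of_real (Re z / (2 * t) + c * v)))"
    using c by (intro lborel_integral_real_affine) auto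
  also have "\<dots> = of_real c * (exp (of_real ((Re z)\<^sup>2 / (4 * t)) + \<i> * of_real (Re z * Im z / (2 * t))) *
      (of_real (sqrt (2 * pi)) * of_real (exp (- (Im z * c)\<^sup>2 / 2))))"
    unfolding * char[symmetric] using c
    by (simp only: exp_add[of "_ + _" "_ + _"] exp_add[of "of_real (- _\<^sup>2 / 2)"] exp_of_real
        scaleR_conv_of_real integral_mult_right_zero abs_of_pos)
  also have "of_real (exp (- (Im z * c)\<^sup>2 / 2)) = exp (of_real (- (Im z)\<^sup>2 / (4 * t)) :: complex)"
    using c by (simp add: power_mult_distrib exp_of_real[symmetric])
  also have "of_real c * (exp (of_real ((Re z)\<^sup>2 / (4 * t)) + \<i> * of_real (Re z * Im z / (2 * t))) *
      (of_real (sqrt (2 * pi)) * exp (of_real (- (Im z)\<^sup>2 / (4 * t)) :: complex))) =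
      of_real (c * sqrt (2 * pi)) * exp ((of_real ((Re z)\<^sup>2 / (4 * t)) + \<i> * of_real (Re z * Im z / (2 * t))) + of_real (- (Im z)\<^sup>2 / (4 * t)))"
    unfolding exp_add by simp
  also have "(of_real ((Re z)\<^sup>2 / (4 * t)) + \<i> * of_real (Re z * Im z / (2 * t))) + of_real (- (Im z)\<^sup>2 / (4 * t)) = z\<^sup>2 / of_real (4 * t)"
    using t by (simp add: complex_eq_iff Re_divide_of_real Im_divide_of_real field_simps power2_eq_square)
  also have "c * sqrt (2 * pi) = sqrt pi * t powr (-1/2)"
    using t by (simp add: c_def real_sqrt_mult powr_minus_divide powr_half_sqrt[symmetric] powr_divide)
  finally show ?thesis by simp
qed

subsection \<open>The contour\<close>

lemma has_vector_derivative_right_branch: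
  "\<tau> > 0 \<Longrightarrow> (right_branch has_vector_derivative Complex (- pi / (2 * \<tau>\<^sup>2)) 1) (at \<tau>)"
  unfolding right_branch_def has_vector_derivative_complex_iff
  by (auto intro!: derivative_eq_intros simp: power2_eq_square field_simps)

lemma has_vector_derivative_left_branch:
  "\<tau> > 0 \<Longrightarrow> (left_branch has_vector_derivative Complex (pi / (2 * \<tau>\<^sup>2)) 1) (at \<tau>)"
  unfolding left_branch_def has_vector_derivative_complex_iff
  by (auto intro!: derivative_eq_intros simp: power2_eq_square field_simps)

text \<open>
  The contour traversed by a single real parameter, so that the contour integral becomes one
  Lebesgue integral over the real line.
\<close>

definition gpath :: "real \<Rightarrow> real \<Rightarrow> complex" where
  "gpath M s = (if s \<le> 0 then right_branch (M - s)
                else if s < 1 then linepath (right_branch M) (left_branch M) s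
                else left_branch (M + s - 1))"

text \<open>The derivative of \<open>gpath M\<close> away from the break points 0 and 1. On the
  first piece the downward orientation of the right branch is absorbed into the sign.\<close>

definition gder :: "real \<Rightarrow> real \<Rightarrow> complex" where
  "gder M s = (if s \<le> 0 then Complex (pi / (2 * (M - s)\<^sup>2)) (- 1)
               else if s < 1 then left_branch M - right_branch M
               else Complex (pi / (2 * (M + s - 1)\<^sup>2)) 1)"

lemma linepath_branches:
  "linepath (right_branch M) (left_branch M) s = Complex ((1 - 2 * s) * (pi / (2 * M))) M"
  by (simp add: linepath_def right_branch_def left_branch_def complex_eq_iff algebra_simps diff_divide_distrib)

lemma measurable_gpath [measurable]: "gpath M \<in> borel_measurable borel"
  unfolding gpath_def linepath_branches unfolding right_branch_def left_branch_def Complex_eq by measurable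

lemma measurable_gder [measurable]: "gder M \<in> borel_measurable borel"
  unfolding gder_def right_branch_def left_branch_def Complex_eq by measurable

lemma Im_gpath: "Im (gpath M s) \<ge> M"
  unfolding gpath_def linepath_branches by (simp add: right_branch_def left_branch_def)

lemma Re_gpath:
  assumes "M > 0" shows "\<bar>Re (gpath M s)\<bar> \<le> pi / (2 * M)"
proof -
  have "\<bar>(1 - 2 * s) * (pi / (2 * M))\<bar> \<le> 1 * (pi / (2 * M))" if "0 < s" "s < 1"
    unfolding abs_mult using assms that by (intro mult_mono) auto
  then show ?thesis
    using assms unfolding gpath_def linepath_branches
    by (auto simp: right_branch_def left_branch_def intro!: divide_left_mono)
qed

lemma norm_gder:
  assumes "M > 0" shows "norm (gder M s) \<le> 1 + pi / (2 * M\<^sup>2) + pi / M"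
proof -
  have *: "pi / (2 * \<tau>\<^sup>2) \<le> pi / (2 * M\<^sup>2)" if "\<tau> \<ge> M" for \<tau>
    using assms that by (intro divide_left_mono) auto
  have **: "norm (Complex (pi / (2 * \<tau>\<^sup>2)) b) \<le> 1 + pi / (2 * M\<^sup>2)" if "\<tau> \<ge> M" "\<bar>b\<bar> = 1" for \<tau> b
    using cmod_le[of "Complex (pi / (2 * \<tau>\<^sup>2)) b"] *[OF that(1)] that by simp
  have "norm (left_branch M - right_branch M) = pi / M"
    using assms by (simp add: left_branch_def right_branch_def cmod_def real_sqrt_abs)
  then show ?thesis
    using **[of "M - s" "-1"] **[of "M + s - 1" 1] assms unfolding gder_def by (auto intro: order_trans)
qed

text \<open>The line is cut at 0 and 1, and the substitutions \<open>s = M - \<tau>\<close> and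
  \<open>s = \<tau> + 1 - M\<close> turn the outer pieces into the two branches. The sign in
  \<open>gder\<close> on the first piece becomes the minus sign in
  \<open>gamma_integral\<close>.\<close>

lemma gamma_integral_line:
  assumes M: "M > 0" and F: "continuous_on (closed_segment (right_branch M) (left_branch M)) F"
    and int: "integrable lborel (\<lambda>s. F (gpath M s) * gder M s)"
  shows "gamma_integrable M F" "gamma_integral M F = (LBINT s. F (gpath M s) * gder M s)"
proof -
  let ?h = "\<lambda>s. F (gpath M s) * gder M s"
  let ?I = "\<lambda>S s. indicator S s *\<^sub>R ?h s"
  let ?R = "\<lambda>\<tau>. F (right_branch \<tau>) * vector_derivative right_branch (at \<tau>)"
  let ?L = "\<lambda>\<tau>. F (left_branch \<tau>) * vector_derivative left_branch (at \<tau>)"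
  let ?s = "linepath (right_branch M) (left_branch M)"
  have I: "integrable lborel (?I S)" if "S \<in> sets borel" for S
    by (rule integrable_mult_indicator) (use that int in auto)
  have R: "?I {..0} (M + (- 1) * \<tau>) = - (indicator {M..} \<tau> *\<^sub>R ?R \<tau>)" for \<tau>
    using vector_derivative_at[OF has_vector_derivative_right_branch[of \<tau>]] M
    by (auto simp: indicator_def gpath_def gder_def complex_eq_iff)
  have L: "?I {1..} ((1 - M) + 1 * \<tau>) = indicator {M..} \<tau> *\<^sub>R ?L \<tau>" for \<tau>
    using vector_derivative_at[OF has_vector_derivative_left_branch[of \<tau>]] M
    by (auto simp: indicator_def gpath_def gder_def complex_eq_iff)
  have "integrable lborel (\<lambda>\<tau>. ?I {..0} (M + (- 1) * \<tau>))"
    by (intro lborel_integrable_real_affine I) auto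
  then have iR: "set_integrable lborel {M..} ?R"
    unfolding set_integrable_def R by simp
  have "integrable lborel (\<lambda>\<tau>. ?I {1..} ((1 - M) + 1 * \<tau>))"
    by (intro lborel_integrable_real_affine I) auto
  then have iL: "set_integrable lborel {M..} ?L"
    unfolding set_integrable_def L by simp
  have iS: "F contour_integrable_on ?s"
    by (rule contour_integrable_continuous_linepath[OF F])
  from iR iL iS show "gamma_integrable M F" by (simp add: gamma_integrable_def)
  have 1: "(LBINT s. ?I {..0} s) = - (LBINT \<tau>:{M..}. ?R \<tau>)"
    using lborel_integral_real_affine[of "-1" "?I {..0}" M] unfolding R
    by (simp add: set_lebesgue_integral_def)
  have 3: "(LBINT s. ?I {1..} s) = (LBINT \<tau>:{M..}. ?L \<tau>)"
    using lborel_integral_real_affine[of "1" "?I {1..}" "1 - M"] unfolding L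
    by (simp add: set_lebesgue_integral_def)
  have "(LBINT s. ?I {0<..<1} s) = integral {0<..<1} ?h"
    using set_borel_integral_eq_integral(2)[of "{0<..<1}" ?h] I[of "{0<..<1}"]
    by (simp add: set_integrable_def set_lebesgue_integral_def)
  also have "\<dots> = integral {0<..<1} (\<lambda>s. F (?s s) * vector_derivative ?s (at s))"
    by (intro integral_cong) (simp add: gpath_def gder_def)
  also have "\<dots> = contour_integral ?s F"
    by (simp add: contour_integral_integral integral_open_interval_real)
  finally have 2: "(LBINT s. ?I {0<..<1} s) = contour_integral ?s F" .
  have "(LBINT s. ?h s) = (LBINT s. ?I {..0} s + ?I {0<..<1} s + ?I {1..} s)"
    by (intro Bochner_Integration.integral_cong) (auto simp: indicator_def)
  also have "\<dots> = (LBINT s. ?I {..0} s) + (LBINT s. ?I {0<..<1} s) + (LBINT s. ?I {1..} s)"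
    using I[of "{..0}"] I[of "{0<..<1}"] I[of "{1..}"] by simp
  finally show "gamma_integral M F = (LBINT s. ?h s)"
    unfolding 1 2 3 gamma_integral_def by simp
qed

section \<open>Doubly exponential decay along the contour\<close>

definition exp_exp :: "complex \<Rightarrow> complex" where
  "exp_exp \<zeta> = exp (exp (- (\<zeta>\<^sup>2)))"

lemma holomorphic_exp_exp [holomorphic_intros]: "f holomorphic_on S \<Longrightarrow> (\<lambda>z. exp_exp (f z)) holomorphic_on S"
  unfolding exp_exp_def by (intro holomorphic_intros)

lemma measurable_exp_exp [measurable]: "exp_exp \<in> borel_measurable borel"
  unfolding exp_exp_def by measurable

text \<open>On the branches \<open>2 * b * \<tau>\<close> is \<open>pi\<close> or
  \<open>- pi\<close>, so the modulus is \<open>exp (- exp (\<tau>\<^sup>2 - b\<^sup>2))\<close>, at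
  most \<open>exp (- u)\<close> with \<open>u\<close> a constant times
  \<open>exp (\<tau>\<^sup>2)\<close>. The inequality
  \<open>exp u \<ge> (u / (n + 1)) ^ (n + 1)\<close> yields n + 1 factors
  \<open>exp (- \<tau>\<^sup>2)\<close>: n of them absorb \<open>exp (n * \<tau>)\<close>, because
  \<open>\<tau> \<le> \<tau>\<^sup>2 + 1\<close>, and one is left for integrability.\<close>

lemma exp_exp_branch_bound:
  assumes M: "M > 0" and \<tau>: "\<tau> \<ge> M" and b: "b = pi / (2 * \<tau>) \<or> b = - pi / (2 * \<tau>)"
  shows "norm (exp_exp (Complex b \<tau>)) * exp (real n * \<tau>)
    \<le> (real (Suc n) / exp (- (pi / (2 * M))\<^sup>2)) ^ Suc n * exp (real n) * exp (- \<tau>\<^sup>2)"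
proof -
  define c where "c = exp (- (pi / (2 * M))\<^sup>2)"
  define u where "u = c * exp (\<tau>\<^sup>2)"
  have u: "u > 0" by (simp add: u_def c_def)
  have b\<tau>2: "2 * (b * \<tau>) = pi \<or> 2 * (b * \<tau>) = - pi" using b M \<tau> by auto
  have "b\<^sup>2 = (pi / (2 * \<tau>))\<^sup>2" using b by auto
  also have "\<dots> \<le> (pi / (2 * M))\<^sup>2"
    using M \<tau> by (intro power_mono divide_left_mono) auto
  finally have b2: "b\<^sup>2 \<le> (pi / (2 * M))\<^sup>2" .
  have "Re (exp (- (Complex b \<tau>)\<^sup>2)) = exp (\<tau>\<^sup>2 - b\<^sup>2) * cos (- (2 * (b * \<tau>)))"
    by (simp add: Re_exp power2_eq_square algebra_simps)
  also have "cos (- (2 * (b * \<tau>))) = -1" using b\<tau>2 by auto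
  finally have "norm (exp_exp (Complex b \<tau>)) = exp (- exp (\<tau>\<^sup>2 - b\<^sup>2))"
    by (simp add: exp_exp_def)
  also have "\<dots> \<le> exp (- u)"
    using b2 by (simp add: u_def c_def exp_add[symmetric])
  also have "\<dots> \<le> (real (Suc n) / u) ^ Suc n"
  proof -
    have "(u / real (Suc n)) ^ Suc n \<le> (1 + u / real (Suc n)) ^ Suc n"
      using u by (intro power_mono) auto
    also have "\<dots> \<le> exp u"
      using u by (intro exp_ge_one_plus_x_over_n_power_n) auto
    finally have "inverse (exp u) \<le> inverse ((u / real (Suc n)) ^ Suc n)"
      using u by (intro le_imp_inverse_le) auto
    then show ?thesis by (simp only: exp_minus power_inverse[symmetric] inverse_divide)
  qed
  also have "\<dots> = (real (Suc n) / c) ^ Suc n * exp (- real (Suc n) * \<tau>\<^sup>2)"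
  proof -
    have "exp (- real (Suc n) * \<tau>\<^sup>2) = inverse (exp (\<tau>\<^sup>2)) ^ Suc n"
      using exp_of_nat_mult[of "Suc n" "- \<tau>\<^sup>2"] by (simp only: exp_minus mult_minus_left mult_minus_right)
    then show ?thesis
      by (simp only: u_def power_mult_distrib[symmetric]) (simp add: divide_inverse mult.assoc)
  qed
  finally have 1: "norm (exp_exp (Complex b \<tau>)) \<le> (real (Suc n) / c) ^ Suc n * exp (- real (Suc n) * \<tau>\<^sup>2)" .
  have "\<tau> \<le> \<tau>\<^sup>2 + 1" using zero_le_power2[of "\<tau> - 1 / 2"] by (simp add: power2_eq_square algebra_simps)
  then have "real n * \<tau> \<le> real n * (\<tau>\<^sup>2 + 1)" by (intro mult_left_mono) auto
  then have 2: "exp (real n * \<tau>) \<le> exp (real n * (\<tau>\<^sup>2 + 1))" by simp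
  have "norm (exp_exp (Complex b \<tau>)) * exp (real n * \<tau>)
      \<le> ((real (Suc n) / c) ^ Suc n * exp (- real (Suc n) * \<tau>\<^sup>2)) * exp (real n * (\<tau>\<^sup>2 + 1))"
    using 1 2 order_trans[OF norm_ge_zero 1] by (intro mult_mono) auto
  also have "\<dots> = (real (Suc n) / c) ^ Suc n * exp (real n) * exp (- \<tau>\<^sup>2)"
  proof -
    have "exp (- real (Suc n) * \<tau>\<^sup>2) * exp (real n * (\<tau>\<^sup>2 + 1)) = exp (real n) * exp (- \<tau>\<^sup>2)"
      by (simp only: exp_add[symmetric]) (simp add: algebra_simps)
    then show ?thesis by (simp only: mult.assoc)
  qed
  finally show ?thesis by (simp add: c_def)
qed

text \<open>The weight \<open>exp (n * Im \<zeta>)\<close> leaves room for the powers of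
  \<open>\<zeta> + \<i> * x\<close> that differentiation of the kernel produces. In the parameter
  \<open>s\<close> the branches are shifted, so \<open>exp (- \<tau>\<^sup>2)\<close> weakens to
  \<open>exp (1 - s\<^sup>2 / 2)\<close>, on the left branch through
  \<open>(s - 1)\<^sup>2 \<ge> s\<^sup>2 / 2 - 1\<close>. On the segment this factor is at least 1
  and the crude bound \<open>exp (exp (M\<^sup>2))\<close> suffices.\<close>

lemma exp_exp_gpath_bound:
  assumes M: "M > 0"
  shows "\<exists>C\<ge>0. \<forall>s. norm (exp_exp (gpath M s) * gder M s) * exp (real n * Im (gpath M s)) \<le> C * exp (- (1/2) * s\<^sup>2)"
proof -
  define C1 where "C1 = (real (Suc n) / exp (- (pi / (2 * M))\<^sup>2)) ^ Suc n * exp (real n)"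
  define C2 where "C2 = exp (exp (M\<^sup>2)) * exp (real n * M)"
  define D where "D = 1 + pi / (2 * M\<^sup>2) + pi / M"
  define C where "C = exp 1 * (C1 + C2)"
  have C12: "C1 \<ge> 0" "C2 \<ge> 0" "D \<ge> 0" using M by (auto simp: C1_def C2_def D_def)
  have main: "norm (exp_exp (gpath M s)) * exp (real n * Im (gpath M s)) \<le> C * exp (- (1/2) * s\<^sup>2)" for s
  proof -
    have C: "C * exp (- (1/2) * s\<^sup>2) = (C1 + C2) * exp (1 - s\<^sup>2 / 2)"
      using exp_add[of 1 "- (1/2) * s\<^sup>2"] by (simp add: C_def)
    have C: "C1 * exp (1 - s\<^sup>2 / 2) \<le> C * exp (- (1/2) * s\<^sup>2)" "C2 * exp (1 - s\<^sup>2 / 2) \<le> C * exp (- (1/2) * s\<^sup>2)"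
      using C12 mult_right_mono[of C1 "C1 + C2" "exp (1 - s\<^sup>2 / 2)"] mult_right_mono[of C2 "C1 + C2" "exp (1 - s\<^sup>2 / 2)"]
      unfolding C by simp_all
    consider "s \<le> 0" | "0 < s" "s < 1" | "s \<ge> 1" by linarith
    then show ?thesis
    proof cases
      case 1
      have "s\<^sup>2 \<le> (M - s)\<^sup>2" using power_mono[of "-s" "M - s" 2] M 1 by simp
      then have "exp (- (M - s)\<^sup>2) \<le> exp (1 - s\<^sup>2 / 2)" using zero_le_power2[of s] unfolding exp_le_cancel_iff by linarith
      from mult_left_mono[OF this C12(1)]
        exp_exp_branch_bound[OF M, of "M - s" "pi / (2 * (M - s))" n] C(1) 1
      show ?thesis by (simp add: gpath_def right_branch_def C1_def)
    next
      case 2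
      define z where "z = gpath M s"
      have z: "Im z = M" using 2 by (simp add: z_def gpath_def linepath_branches)
      have "norm (exp_exp z) = exp (Re (exp (- z\<^sup>2)))" by (simp add: exp_exp_def)
      also have "Re (exp (- z\<^sup>2)) \<le> norm (exp (- z\<^sup>2))" by (rule complex_Re_le_cmod)
      also have "\<dots> \<le> exp (M\<^sup>2)" by (simp add: z power2_eq_square)
      finally have "norm (exp_exp z) * exp (real n * Im z) \<le> C2" by (simp add: C2_def z)
      also have "C2 * 1 \<le> C2 * exp (1 - s\<^sup>2 / 2)"
        using 2 power_le_one[of s 2] C12(2) by (intro mult_left_mono) auto
      finally show ?thesis using C(2) by (simp add: z_def)
    next
      case 3
      have "(s - 1)\<^sup>2 \<le> (M + s - 1)\<^sup>2" using M 3 by (intro power_mono) auto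
      moreover have "(s - 1)\<^sup>2 \<ge> s\<^sup>2 / 2 - 1"
        using zero_le_power2[of "s - 2"] by (simp add: power2_eq_square algebra_simps)
      ultimately have "exp (- (M + s - 1)\<^sup>2) \<le> exp (1 - s\<^sup>2 / 2)" by simp
      from mult_left_mono[OF this C12(1)]
        exp_exp_branch_bound[OF M, of "M + s - 1" "- pi / (2 * (M + s - 1))" n] C(1) 3
      show ?thesis by (simp add: gpath_def left_branch_def C1_def)
    qed
  qed
  have "norm (exp_exp (gpath M s) * gder M s) * exp (real n * Im (gpath M s)) \<le> (C * D) * exp (- (1/2) * s\<^sup>2)" for s
  proof -
    have "norm (exp_exp (gpath M s) * gder M s) * exp (real n * Im (gpath M s)) =
       (norm (exp_exp (gpath M s)) * exp (real n * Im (gpath M s))) * norm (gder M s)"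
      by (simp add: norm_mult)
    also have "\<dots> \<le> (C * exp (- (1/2) * s\<^sup>2)) * D"
      by (rule mult_mono[OF main norm_gder[OF M, folded D_def]]) (use C12 in \<open>auto simp: C_def\<close>)
    finally show ?thesis by (simp add: mult_ac)
  qed
  moreover have "C * D \<ge> 0" using C12 by (simp add: C_def)
  ultimately show ?thesis by blast
qed

lemma integrable_exp_exp_gpath:
  assumes M: "M > 0"
  shows "integrable lborel (\<lambda>s. norm (exp_exp (gpath M s) * gder M s) * exp (real n * Im (gpath M s)))"
proof -
  obtain C where C: "\<And>s. norm (exp_exp (gpath M s) * gder M s) * exp (real n * Im (gpath M s)) \<le> C * exp (- (1/2) * s\<^sup>2)"
    using exp_exp_gpath_bound[OF M, of n] by blast
  show ?thesis
    by (rule Bochner_Integration.integrable_bound[OF integrable_mult_right[OF integrable_gauss[of "1/2"], of C]])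
      (use C in \<open>auto intro!: AE_I2 order_trans[OF _ abs_ge_self]\<close>)
qed

text \<open>The form in which the decay is mostly applied: a factor growing at most like
  \<open>exp (n * Im \<zeta>)\<close> keeps the contour integral absolutely convergent.\<close>

lemma integrable_exp_exp_gpath_mult:
  assumes M: "M > 0" and k[measurable]: "k \<in> borel_measurable borel"
    and bd: "\<And>s. norm (k (gpath M s)) \<le> B * exp (real n * Im (gpath M s))"
  shows "integrable lborel (\<lambda>s. exp_exp (gpath M s) * k (gpath M s) * gder M s)"
proof (rule Bochner_Integration.integrable_bound[OF integrable_mult_right[OF integrable_exp_exp_gpath[OF M, of n], of B]])
  have "norm (exp_exp (gpath M s) * k (gpath M s) * gder M s)
      \<le> B * (norm (exp_exp (gpath M s) * gder M s) * exp (real n * Im (gpath M s)))" for s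
    using mult_left_mono[OF bd[of s], of "norm (exp_exp (gpath M s) * gder M s)"]
    by (simp add: norm_mult mult_ac)
  then show "AE s in lborel. norm (exp_exp (gpath M s) * k (gpath M s) * gder M s)
      \<le> norm (B * (norm (exp_exp (gpath M s) * gder M s) * exp (real n * Im (gpath M s))))"
    by (intro AE_I2) (auto intro: order_trans[OF _ abs_ge_self])
qed measurable

subsection \<open>The heat kernel on the contour\<close>

lemma FTC_along_path:
  fixes p :: "real \<Rightarrow> complex"
  assumes le: "m \<le> M"
    and p: "\<And>\<tau>. \<tau> \<in> {m..M} \<Longrightarrow> (p has_vector_derivative p' \<tau>) (at \<tau>)" "continuous_on {m..M} p'"
    and P: "\<And>\<tau>. \<tau> \<in> {m..M} \<Longrightarrow> (P has_field_derivative F (p \<tau>)) (at (p \<tau>))" "continuous_on (p ` {m..M}) F"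
  shows "set_integrable lborel {m..M} (\<lambda>\<tau>. F (p \<tau>) * vector_derivative p (at \<tau>))"
    and "(LBINT \<tau>:{m..M}. F (p \<tau>) * vector_derivative p (at \<tau>)) = P (p M) - P (p m)"
proof -
  have "continuous_on {m..M} p"
    using p(1) by (meson continuous_at_imp_continuous_on has_vector_derivative_continuous)
  then have c: "continuous_on {m..M} (\<lambda>\<tau>. F (p \<tau>) * p' \<tau>)"
    by (intro continuous_intros continuous_on_compose2[OF P(2)] p) auto
  have *: "indicator {m..M} \<tau> *\<^sub>R (F (p \<tau>) * vector_derivative p (at \<tau>)) = indicator {m..M} \<tau> *\<^sub>R (F (p \<tau>) * p' \<tau>)" for \<tau>
    using vector_derivative_at[OF p(1)] by (auto simp: indicator_def)
  have "((\<lambda>\<tau>. P (p \<tau>)) has_vector_derivative (F (p \<tau>) * p' \<tau>)) (at \<tau> within {m..M})" if "m \<le> \<tau>" "\<tau> \<le> M" for \<tau>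
    using field_vector_diff_chain_at[OF p(1) P(1), of \<tau>] that
    by (auto simp: o_def mult.commute intro: has_vector_derivative_at_within)
  from integral_FTC_atLeastAtMost[OF le this c]
  show "(LBINT \<tau>:{m..M}. F (p \<tau>) * vector_derivative p (at \<tau>)) = P (p M) - P (p m)"
    unfolding set_lebesgue_integral_def * .
  show "set_integrable lborel {m..M} (\<lambda>\<tau>. F (p \<tau>) * vector_derivative p (at \<tau>))"
    using borel_integrable_atLeastAtMost'[OF c] unfolding set_integrable_def * .
qed

text \<open>
  The four sides of the region between the two contours carry separate primitives, so that
  different branches of the logarithm can be used on them.
\<close>

lemma gamma_integral_diff:
  assumes mM: "0 < m" "m \<le> M"
    and int: "gamma_integrable m F" "gamma_integrable M F"
    and P1: "\<And>\<tau>. \<tau> \<in> {m..M} \<Longrightarrow> (P1 has_field_derivative F (right_branch \<tau>)) (at (right_branch \<tau>))"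
      "continuous_on (right_branch ` {m..M}) F"
    and P2: "\<And>z. z \<in> closed_segment (right_branch m) (left_branch m) \<Longrightarrow> (P2 has_field_derivative F z) (at z)"
    and P3: "\<And>z. z \<in> closed_segment (right_branch M) (left_branch M) \<Longrightarrow> (P3 has_field_derivative F z) (at z)"
    and P4: "\<And>\<tau>. \<tau> \<in> {m..M} \<Longrightarrow> (P4 has_field_derivative F (left_branch \<tau>)) (at (left_branch \<tau>))"
      "continuous_on (left_branch ` {m..M}) F"
  shows "gamma_integral m F - gamma_integral M F =
    - (P1 (right_branch M) - P1 (right_branch m)) + (P2 (left_branch m) - P2 (right_branch m))
    - (P3 (left_branch M) - P3 (right_branch M)) + (P4 (left_branch M) - P4 (left_branch m))"
proof -
  have split: "(LBINT \<tau>:{m..}. f \<tau>) = (LBINT \<tau>:{m..M}. f \<tau>) + (LBINT \<tau>:{M..}. f \<tau>)"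
    if "set_integrable lborel {m..M} f" "set_integrable lborel {M..} f" for f :: "real \<Rightarrow> complex"
  proof -
    have "{m..} = {m..M} \<union> {M..}" using mM by auto
    moreover have "AE x in lborel. \<not> (x \<in> {m..M} \<and> x \<in> {M..})"
      using AE_lborel_singleton[of M] by eventually_elim auto
    ultimately show ?thesis
      using that by (simp only:) (intro set_integral_Un_AE, auto)
  qed
  have cR: "continuous_on {m..M} (\<lambda>\<tau>. Complex (- pi / (2 * \<tau>\<^sup>2)) 1)"
    and cL: "continuous_on {m..M} (\<lambda>\<tau>. Complex (pi / (2 * \<tau>\<^sup>2)) 1)"
    unfolding Complex_eq using mM by (auto intro!: continuous_intros)
  have R: "set_integrable lborel {m..M} (\<lambda>\<tau>. F (right_branch \<tau>) * vector_derivative right_branch (at \<tau>))"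
    "(LBINT \<tau>:{m..M}. F (right_branch \<tau>) * vector_derivative right_branch (at \<tau>)) = P1 (right_branch M) - P1 (right_branch m)"
    using FTC_along_path[OF mM(2) has_vector_derivative_right_branch cR P1] mM by auto
  have L: "set_integrable lborel {m..M} (\<lambda>\<tau>. F (left_branch \<tau>) * vector_derivative left_branch (at \<tau>))"
    "(LBINT \<tau>:{m..M}. F (left_branch \<tau>) * vector_derivative left_branch (at \<tau>)) = P4 (left_branch M) - P4 (left_branch m)"
    using FTC_along_path[OF mM(2) has_vector_derivative_left_branch cL P4] mM by auto
  have S: "contour_integral (linepath a b) F = P b - P a"
    if "\<And>z. z \<in> closed_segment a b \<Longrightarrow> (P has_field_derivative F z) (at z)" for a b P
    using contour_integral_primitive[of "closed_segment a b" P F "linepath a b"] that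
    by (auto simp: has_field_derivative_at_within intro!: contour_integral_unique)
  have "set_integrable lborel {M..} (\<lambda>\<tau>. F (right_branch \<tau>) * vector_derivative right_branch (at \<tau>))"
    "set_integrable lborel {M..} (\<lambda>\<tau>. F (left_branch \<tau>) * vector_derivative left_branch (at \<tau>))"
    using int(2) unfolding gamma_integrable_def by blast+
  note split[OF R(1) this(1)] split[OF L(1) this(2)]
  moreover have "contour_integral (linepath (right_branch m) (left_branch m)) F = P2 (left_branch m) - P2 (right_branch m)"
    by (rule S[OF P2])
  moreover have "contour_integral (linepath (right_branch M) (left_branch M)) F = P3 (left_branch M) - P3 (right_branch M)"
    by (rule S[OF P3])
  ultimately show ?thesis
    unfolding gamma_integral_def R(2) L(2) by simp
qed

text \<open>An entire function has a global primitive, so the boundary terms on the four sides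
  cancel. Both contours share their branches above the greater height, hence only a bounded region
  is involved.\<close>

lemma gamma_integral_entire:
  assumes F: "F holomorphic_on UNIV" and mM: "0 < m" "0 < M"
    and int: "gamma_integrable m F" "gamma_integrable M F"
  shows "gamma_integral m F = gamma_integral M F"
proof -
  obtain P where P: "\<And>z. (P has_field_derivative F z) (at z)"
    using holomorphic_convex_primitive'[OF convex_UNIV open_UNIV F] by auto
  have c: "continuous_on S F" for S
    using holomorphic_on_imp_continuous_on[OF F] continuous_on_subset by blast
  have le: "gamma_integral m F = gamma_integral M F"
    if "0 < m" "m \<le> M" "gamma_integrable m F" "gamma_integrable M F" for m M
  proof -
    have "gamma_integral m F - gamma_integral M F =
      - (P (right_branch M) - P (right_branch m)) + (P (left_branch m) - P (right_branch m))
      - (P (left_branch M) - P (right_branch M)) + (P (left_branch M) - P (left_branch m))"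
      by (rule gamma_integral_diff[OF that]) (rule P c)+
    then show ?thesis by simp
  qed
  show ?thesis
  proof (cases "m \<le> M")
    case True
    show ?thesis by (rule le[OF mM(1) True int])
  next
    case False
    then show ?thesis using le[OF mM(2) _ int(2,1)] by simp
  qed
qed

section \<open>The heat kernel, its decay as t tends to 0, and its derivatives\<close>

text \<open>
  Since \<open>0 powr a = 0\<close>, the kernel is 0 for \<open>t = 0\<close>, which is its continuous extension wherever
  \<open>z\<^sup>2\<close> has negative real part.
\<close>

definition heat_ker :: "nat \<Rightarrow> real \<Rightarrow> complex \<Rightarrow> real \<Rightarrow> complex" where
  "heat_ker j a z t = of_real (t powr a) * z ^ j * exp (z\<^sup>2 / of_real (4 * t))"

lemma heat_ker_0 [simp]: "heat_ker j a z 0 = 0"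
  by (simp add: heat_ker_def)

lemma norm_heat_ker: "norm (heat_ker j a z t) = t powr a * exp (Re (z\<^sup>2) / (4 * t)) * norm z ^ j"
  by (simp add: heat_ker_def norm_mult norm_power Re_divide_of_real del: of_real_mult)

lemma measurable_heat_ker [measurable]: "(\<lambda>z. heat_ker j a z t) \<in> borel_measurable borel"
  unfolding heat_ker_def by measurable

text \<open>With \<open>u = 3 / (4 * t)\<close>, the inequality
  \<open>exp u \<ge> (u / N) ^ N\<close> makes \<open>exp (- u)\<close> of order
  \<open>t ^ N\<close>, and \<open>N\<close> is chosen with \<open>a + N \<ge> 2\<close>. The
  uniform bound later dominates integrals; the quadratic one is o(t), which gives differentiability
  at t = 0 with derivative 0. At t = 0 itself the left-hand sides vanish by
  \<open>0 powr a = 0\<close>.\<close>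

lemma powr_exp_bound:
  fixes a :: real
  assumes "a \<le> 0"
  shows "\<exists>C\<ge>0. \<forall>t\<ge>0::real. t powr a * exp (- 3 / (4 * t)) \<le> C \<and> (t \<le> 1 \<longrightarrow> t powr a * exp (- 3 / (4 * t)) \<le> C * t\<^sup>2)"
proof -
  define N where "N = nat \<lceil>- a\<rceil> + 2"
  have N: "a + real N \<ge> 2" "N > 0" unfolding N_def by linarith+
  define C where "C = max 1 ((4 * real N / 3) ^ N)"
  have small: "t powr a * exp (- 3 / (4 * t)) \<le> C * t\<^sup>2" if t: "0 < t" "t \<le> 1" for t
  proof -
    define u where "u = 3 / (4 * t)"
    have u: "u > 0" using t by (simp add: u_def)
    have "(u / real N) ^ N \<le> (1 + u / real N) ^ N"
      using u by (intro power_mono) auto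
    also have "\<dots> \<le> exp u"
      using u N by (intro exp_ge_one_plus_x_over_n_power_n) auto
    finally have "inverse (exp u) \<le> inverse ((u / real N) ^ N)"
      using u N by (intro le_imp_inverse_le) auto
    also have "\<dots> = (4 * real N / 3) ^ N * t ^ N"
      using t by (simp only: power_inverse[symmetric] power_mult_distrib[symmetric]) (simp add: u_def field_simps)
    finally have "exp (- u) \<le> C * t ^ N"
      using t by (auto simp: exp_minus C_def intro: order_trans mult_right_mono)
    then have "t powr a * exp (- u) \<le> t powr a * (C * t powr real N)"
      using t by (intro mult_left_mono) (auto simp: powr_realpow)
    also have "\<dots> = C * t powr (a + real N)"
      by (simp add: powr_add)
    also have "\<dots> \<le> C * t powr 2"
      using t N by (intro mult_left_mono powr_mono') (auto simp: C_def)
    finally show ?thesis using t by (simp add: u_def)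
  qed
  have "t powr a * exp (- 3 / (4 * t)) \<le> C" if t0: "t \<ge> 0" for t
  proof -
    consider "t = 0" | "0 < t" "t \<le> 1" | "t > 1" using t0 by linarith
    then show ?thesis
    proof cases
      case 2
      have "C * t\<^sup>2 \<le> C * 1" using 2 by (intro mult_left_mono power_le_one) (auto simp: C_def)
      with small[OF 2] show ?thesis by simp
    next
      case 3
      have "t powr a * exp (- 3 / (4 * t)) \<le> 1 * 1"
        using 3 assms powr_mono[of a 0 t] by (intro mult_mono) auto
      then show ?thesis by (simp add: C_def)
    qed (simp add: C_def)
  qed
  moreover have "t powr a * exp (- 3 / (4 * t)) \<le> C * t\<^sup>2" if "0 \<le> t" "t \<le> 1" for t
    using small[of t] that by (cases "t = 0") auto
  ultimately show ?thesis
    by (intro exI[of _ C]) (auto simp: C_def)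
qed

lemma heat_ker_bound:
  assumes a: "a \<le> 0"
  shows "\<exists>C\<ge>0. (\<forall>j z t. t \<ge> 0 \<longrightarrow> Re (z\<^sup>2) \<le> - 3 \<longrightarrow> norm (heat_ker j a z t) \<le> C * norm z ^ j) \<and>
    (\<forall>j z t. 0 \<le> t \<longrightarrow> t \<le> 1 \<longrightarrow> Re (z\<^sup>2) \<le> - 3 \<longrightarrow> norm (heat_ker j a z t) \<le> C * t\<^sup>2 * norm z ^ j)"
proof -
  obtain C where C: "C \<ge> 0" "\<And>t. t \<ge> 0 \<Longrightarrow> t powr a * exp (- 3 / (4 * t)) \<le> C"
    "\<And>t. 0 \<le> t \<Longrightarrow> t \<le> 1 \<Longrightarrow> t powr a * exp (- 3 / (4 * t)) \<le> C * t\<^sup>2"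
    using powr_exp_bound[OF a] by auto
  have *: "t powr a * exp (Re (z\<^sup>2) / (4 * t)) \<le> t powr a * exp (- 3 / (4 * t))"
    if "t \<ge> 0" "Re (z\<^sup>2) \<le> - 3" for t z
    using that divide_right_mono[OF that(2), of "4 * t"] by (intro mult_left_mono) auto
  have "norm (heat_ker j a z t) \<le> C * norm z ^ j" if "t \<ge> 0" "Re (z\<^sup>2) \<le> - 3" for j z t
    unfolding norm_heat_ker using *[OF that] C(2)[OF that(1)]
    by (intro mult_right_mono) auto
  moreover have "norm (heat_ker j a z t) \<le> C * t\<^sup>2 * norm z ^ j" if "0 \<le> t" "t \<le> 1" "Re (z\<^sup>2) \<le> - 3" for j z t
    unfolding norm_heat_ker using *[OF that(1,3)] C(3)[OF that(1,2)]
    by (intro mult_right_mono) auto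
  ultimately show ?thesis using C(1) by metis
qed

text \<open>The parameters \<open>j\<close> and \<open>a\<close> are there to make the family of
  kernels closed under both partial derivatives. For t > 0 this is the product and chain rule; for j
  = 0 the truncated \<open>j - 1\<close> is harmless because of the factor \<open>of_nat j\<close>.
  At t = 0 all kernels on the right are 0, and the claim rests on the quadratic decay.\<close>

lemma heat_ker_has_derivative:
  fixes \<zeta> :: complex
  assumes a: "a \<le> 0" and S: "S \<subseteq> UNIV \<times> {0..}" "(x, t) \<in> S"
    and neg: "\<And>x t. (x, t) \<in> S \<Longrightarrow> Re ((\<zeta> + \<i> * of_real x)\<^sup>2) \<le> - 3"
  defines "z \<equiv> \<zeta> + \<i> * of_real x"
  shows "((\<lambda>p. heat_ker j a (\<zeta> + \<i> * of_real (fst p)) (snd p)) has_derivative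
     (\<lambda>(h, k). h *\<^sub>R (\<i> * of_nat j * heat_ker (j - 1) a z t + \<i> / 2 * heat_ker (j + 1) (a - 1) z t) +
               k *\<^sub>R (of_real a * heat_ker j (a - 1) z t - 1 / 4 * heat_ker (j + 2) (a - 2) z t))) (at (x, t) within S)"
proof (cases "t = 0")
  case False
  with S have t: "t > 0" by auto
  have pw: "t powr (a - 1) = t powr a / t" "t powr (a - 2) = t powr a / t\<^sup>2"
    using t by (simp_all add: powr_diff)
  let ?F = "at (x, t) within S"
  define T where "T = complex_of_real t"
  define E where "E = exp (z\<^sup>2 / of_real (4 * t))"
  have T: "T \<noteq> 0" using t by (simp add: T_def)
  have 1: "((\<lambda>p. complex_of_real (snd p powr a)) has_derivative (\<lambda>p. of_real (a * t powr (a - 1) * snd p))) ?F"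
    using has_derivative_compose[OF has_derivative_snd[OF has_derivative_ident], of "\<lambda>t. t powr a" _ "(x, t)" S]
      has_real_derivative_powr[OF t, of a]
    by (intro has_derivative_of_real) (auto simp: has_field_derivative_def)
  have 2: "((\<lambda>p. \<zeta> + \<i> * complex_of_real (fst p)) has_derivative (\<lambda>p. \<i> * of_real (fst p))) ?F"
    by (auto intro!: derivative_eq_intros)
  have zj: "((\<lambda>z. z ^ j) has_field_derivative of_nat j * z ^ (j - 1)) (at z)"
    and z2: "((\<lambda>z. z\<^sup>2) has_field_derivative 2 * z) (at z)"
    by (auto intro!: derivative_eq_intros)
  have 3: "((\<lambda>p. (\<zeta> + \<i> * complex_of_real (fst p)) ^ j) has_derivative
      (\<lambda>p. of_nat j * z ^ (j - 1) * (\<i> * of_real (fst p)))) ?F"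
    using has_derivative_compose[OF 2, of "\<lambda>z. z ^ j"] zj 
    by (auto simp: has_field_derivative_def z_def)
  have 4: "((\<lambda>p. complex_of_real (1 / (4 * snd p))) has_derivative (\<lambda>p. of_real (- 1 / (4 * t\<^sup>2) * snd p))) ?F"
  proof -
    have "((\<lambda>t. 1 / (4 * t)) has_real_derivative - 1 / (4 * t\<^sup>2)) (at t)"
      using t by (auto intro!: derivative_eq_intros simp: power2_eq_square field_simps)
    then show ?thesis
      using has_derivative_compose[OF has_derivative_snd[OF has_derivative_ident], of "\<lambda>t. 1 / (4 * t)" "(*) (- 1 / (4 * t\<^sup>2))" "(x, t)" S]
      by (intro has_derivative_of_real) (auto simp: has_field_derivative_def)
  qed
  have 5: "((\<lambda>p. (\<zeta> + \<i> * complex_of_real (fst p))\<^sup>2) has_derivative (\<lambda>p. 2 * z * (\<i> * of_real (fst p)))) ?F"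
    using has_derivative_compose[OF 2, of "\<lambda>z. z\<^sup>2"] z2 
    by (auto simp: has_field_derivative_def z_def)
  have 6: "((\<lambda>p. exp ((\<zeta> + \<i> * complex_of_real (fst p))\<^sup>2 * complex_of_real (1 / (4 * snd p)))) has_derivative
      (\<lambda>p. exp (z\<^sup>2 * of_real (1 / (4 * t))) * (z\<^sup>2 * of_real (- 1 / (4 * t\<^sup>2) * snd p)
        + 2 * z * (\<i> * of_real (fst p)) * of_real (1 / (4 * t))))) ?F"
    using has_derivative_compose[OF has_derivative_mult[OF 5 4], of exp] DERIV_exp[of "z\<^sup>2 * of_real (1 / (4 * t))"]
    by (auto simp: has_field_derivative_def z_def)
  have E': "exp (z\<^sup>2 * of_real (1 / (4 * t))) = E" by (simp add: E_def)
  have ker: "heat_ker j b z t = of_real (t powr b) * z ^ j * E" for j b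
    by (simp add: heat_ker_def E_def)
  have "((\<lambda>p. complex_of_real (snd p powr a) * (\<zeta> + \<i> * complex_of_real (fst p)) ^ j *
     exp ((\<zeta> + \<i> * complex_of_real (fst p))\<^sup>2 * complex_of_real (1 / (4 * snd p)))) has_derivative
     (\<lambda>(h, k). h *\<^sub>R (\<i> * of_nat j * heat_ker (j - 1) a z t + \<i> / 2 * heat_ker (j + 1) (a - 1) z t) +
               k *\<^sub>R (of_real a * heat_ker j (a - 1) z t - 1 / 4 * heat_ker (j + 2) (a - 2) z t))) ?F"
  proof (rule has_derivative_eq_rhs[OF has_derivative_mult[OF has_derivative_mult[OF 1 3] 6]], rule ext)
    fix p :: "real \<times> real"
    obtain h k where p: "p = (h, k)" by (cases p)
    have "A * Z * (E * (z\<^sup>2 * (- 1 / (4 * T\<^sup>2) * k) + 2 * z * (\<i> * h) * (1 / (4 * T)))) + (A * (n * W * (\<i> * h)) + b * (A / T) * k * Z) * E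
        = h * (\<i> * n * (A * W * E) + \<i> / 2 * (A / T * (z * Z) * E)) + k * (b * (A / T * Z * E) - 1 / 4 * (A / T\<^sup>2 * (z\<^sup>2 * Z) * E))"
      for A Z W n b h k :: complex
    proof -
      \<comment> \<open>Naming the reciprocals turns the identity into one between
        polynomials.\<close>
      define q I where "q = (1 / 4 :: complex)" and "I = 1 / T"
      have e: "- 1 / (4 * T\<^sup>2) = - (q * I\<^sup>2)" "1 / (4 * T) = q * I" "A / T = A * I" "A / T\<^sup>2 = A * I\<^sup>2" "\<i> / 2 = 2 * q * \<i>" "1 / 4 = q"
        by (simp_all add: q_def I_def power_divide)
      show ?thesis unfolding e by (simp add: algebra_simps)
    qed
    moreover have pj: "z ^ (j + 1) = z * z ^ j" "z ^ (j + 2) = z\<^sup>2 * z ^ j"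
      by (simp_all add: power2_eq_square)
    note calculation[of "of_real (t powr a)" "z ^ j" "of_real k" "of_real h" "of_nat j" "z ^ (j - 1)" "of_real a"]
    then show "complex_of_real (snd (x, t) powr a) * (\<zeta> + \<i> * complex_of_real (fst (x, t))) ^ j *
         (exp (z\<^sup>2 * complex_of_real (1 / (4 * t))) *
          (z\<^sup>2 * complex_of_real (- 1 / (4 * t\<^sup>2) * snd p) + 2 * z * (\<i> * complex_of_real (fst p)) * complex_of_real (1 / (4 * t)))) +
         (complex_of_real (snd (x, t) powr a) * (of_nat j * z ^ (j - 1) * (\<i> * complex_of_real (fst p))) +
          complex_of_real (a * t powr (a - 1) * snd p) * (\<zeta> + \<i> * complex_of_real (fst (x, t))) ^ j) *
         exp ((\<zeta> + \<i> * complex_of_real (fst (x, t)))\<^sup>2 * complex_of_real (1 / (4 * snd (x, t)))) =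
         (case p of (h, k) \<Rightarrow> h *\<^sub>R (\<i> * of_nat j * heat_ker (j - 1) a z t + \<i> / 2 * heat_ker (j + 1) (a - 1) z t) +
               k *\<^sub>R (of_real a * heat_ker j (a - 1) z t - 1 / 4 * heat_ker (j + 2) (a - 2) z t))"
      unfolding p prod.case fst_conv snd_conv z_def[symmetric] E' ker pw scaleR_conv_of_real
      by (simp only: T_def of_real_mult of_real_divide of_real_power of_real_minus of_real_numeral of_real_1 pj)
  qed
  moreover have "heat_ker j a (\<zeta> + \<i> * of_real (fst p)) (snd p) =
     complex_of_real (snd p powr a) * (\<zeta> + \<i> * complex_of_real (fst p)) ^ j *
     exp ((\<zeta> + \<i> * complex_of_real (fst p))\<^sup>2 * complex_of_real (1 / (4 * snd p)))" for p
    by (simp add: heat_ker_def)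
  ultimately show ?thesis by (simp only:)
next
  case True
  obtain C where C: "C \<ge> 0"
    "(\<forall>j z t. t \<ge> 0 \<longrightarrow> Re (z\<^sup>2) \<le> - 3 \<longrightarrow> norm (heat_ker j a z t) \<le> C * norm z ^ j)"
    "(\<forall>j z t. 0 \<le> t \<longrightarrow> t \<le> 1 \<longrightarrow> Re (z\<^sup>2) \<le> - 3 \<longrightarrow> norm (heat_ker j a z t) \<le> C * t\<^sup>2 * norm z ^ j)"
    using heat_ker_bound[OF a] by metis
  let ?f = "\<lambda>p. heat_ker j a (\<zeta> + \<i> * of_real (fst p)) (snd p)"
  let ?z = "\<lambda>p. \<zeta> + \<i> * of_real (fst p)"
  \<comment> \<open>At t = 0 the asserted derivative is 0. The quadratic bound, divided by a
    distance that is at least \<open>snd p\<close>, leaves \<open>C * snd p\<close> times a locally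
    bounded factor.\<close>
  have "((\<lambda>p. norm (?f p - ?f (x, t) - 0) / norm (p - (x, t))) \<longlongrightarrow> 0) (at (x, t) within S)"
  proof (rule tendsto_sandwich[where f = "\<lambda>_. 0"])
    have "((\<lambda>p. C * snd p * norm (?z p) ^ j) \<longlongrightarrow> C * snd (x, t) * norm (?z (x, t)) ^ j) (at (x, t) within S)"
      by (intro tendsto_intros)
    then show "((\<lambda>p. C * snd p * norm (?z p) ^ j) \<longlongrightarrow> 0) (at (x, t) within S)"
      using True by simp
    have "((\<lambda>p. snd p) \<longlongrightarrow> snd (x, t)) (at (x, t) within S)"
      by (intro tendsto_intros)
    then have "\<forall>\<^sub>F p in at (x, t) within S. snd p < 1"
      using True by (auto dest: order_tendstoD(2)[where a=1])
    moreover have "\<forall>\<^sub>F p in at (x, t) within S. p \<in> S \<and> p \<noteq> (x, t)"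
      by (auto simp: eventually_at_filter)
    ultimately show "\<forall>\<^sub>F p in at (x, t) within S. norm (?f p - ?f (x, t) - 0) / norm (p - (x, t)) \<le> C * snd p * norm (?z p) ^ j"
    proof eventually_elim
      case (elim p)
      have p: "0 \<le> snd p" "Re ((?z p)\<^sup>2) \<le> - 3" using elim S neg[of "fst p" "snd p"] by auto
      have "snd p \<le> norm (p - (x, t))"
        using norm_snd_le[of "snd (p - (x, t))" "fst (p - (x, t))"] True by (cases p) auto
      then have "C * (snd p * snd p) * norm (?z p) ^ j \<le> C * (snd p * norm (p - (x, t))) * norm (?z p) ^ j"
        using p C by (intro mult_right_mono mult_left_mono) auto
      with C(3)[rule_format, of "snd p" "?z p" j] elim p True show ?case
        by (auto simp: divide_simps power2_eq_square mult_ac)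
    qed
  qed auto
  then show ?thesis using True
    unfolding has_derivative_iff_norm by (auto simp: case_prod_unfold zero_prod_def)
qed

section \<open>Contour integrals of the kernel: contour independence, smoothness and the heat
  equation\<close>

lemma Re_shift_square: "Re ((\<zeta> + \<i> * of_real x)\<^sup>2) = (Re \<zeta>)\<^sup>2 - (Im \<zeta> + x)\<^sup>2"
  by (simp add: power2_eq_square)

text \<open>Polynomial growth is traded for exponential growth by \<open>y \<le> exp y\<close>, to
  match the weight in \<open>exp_exp_gpath_bound\<close>.\<close>

lemma norm_shift_power_le:
  assumes "0 \<le> Im \<zeta>" "\<bar>Re \<zeta>\<bar> \<le> K" "\<bar>x\<bar> \<le> R"
  shows "norm (\<zeta> + \<i> * of_real x) ^ j \<le> exp (real j * (K + R)) * exp (real j * Im \<zeta>)"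
proof -
  have "norm (\<zeta> + \<i> * of_real x) \<le> \<bar>Re \<zeta>\<bar> + \<bar>Im \<zeta> + x\<bar>"
    using cmod_le[of "\<zeta> + \<i> * of_real x"] by simp
  also have "\<dots> \<le> K + R + Im \<zeta>" using assms by linarith
  also have "\<dots> \<le> exp (K + R + Im \<zeta>)" by (rule order_trans[OF _ exp_ge_add_one_self]) simp
  finally have "norm (\<zeta> + \<i> * of_real x) ^ j \<le> exp (K + R + Im \<zeta>) ^ j"
    by (intro power_mono) auto
  then show ?thesis by (simp add: exp_of_nat_mult[symmetric] exp_add[symmetric] algebra_simps)
qed

definition heat_integral :: "real \<Rightarrow> nat \<Rightarrow> real \<Rightarrow> real \<times> real \<Rightarrow> complex" where
  "heat_integral M j a p = (LBINT s. exp_exp (gpath M s) * heat_ker j a (gpath M s + \<i> * of_real (fst p)) (snd p) * gder M s)"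

text \<open>For fixed t > 0 every height will do: \<open>Re \<zeta>\<close> is bounded on the
  contour, so the real part of \<open>(\<zeta> + \<i> * x)\<^sup>2\<close> is bounded above. The
  resulting bound \<open>exp (?K\<^sup>2 / (4 * t))\<close> blows up as t tends to 0, which is why
  the contour must be raised for uniform estimates.\<close>

lemma integrable_heat_integral:
  assumes M: "M > 0" and t: "t \<ge> 0"
  shows "integrable lborel (\<lambda>s. exp_exp (gpath M s) * heat_ker j a (gpath M s + \<i> * of_real x) t * gder M s)"
proof (cases "t = 0")
  case False
  with t have t: "t > 0" by simp
  let ?K = "pi / (2 * M)"
  let ?B = "t powr a * exp (?K\<^sup>2 / (4 * t)) * exp (real j * (?K + \<bar>x\<bar>))"
  show ?thesis
  proof (rule integrable_exp_exp_gpath_mult[OF M, where n = j and B = ?B])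
    fix s
    let ?\<zeta> = "gpath M s"
    have \<zeta>: "M \<le> Im ?\<zeta>" "\<bar>Re ?\<zeta>\<bar> \<le> ?K" by (rule Im_gpath, rule Re_gpath[OF M])
    have "(Re ?\<zeta>)\<^sup>2 \<le> ?K\<^sup>2" using power_mono[OF \<zeta>(2), of 2] by simp
    then have "Re ((?\<zeta> + \<i> * of_real x)\<^sup>2) \<le> ?K\<^sup>2"
      using zero_le_power2[of "Im ?\<zeta> + x"] unfolding Re_shift_square by linarith
    then have "t powr a * exp (Re ((?\<zeta> + \<i> * of_real x)\<^sup>2) / (4 * t)) \<le> t powr a * exp (?K\<^sup>2 / (4 * t))"
      using t by (intro mult_left_mono) (auto simp del: Re_power2 intro: divide_right_mono)
    from mult_mono[OF this norm_shift_power_le[of ?\<zeta> ?K x "\<bar>x\<bar>" j]] \<zeta> M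
    show "norm (heat_ker j a (?\<zeta> + \<i> * of_real x) t) \<le> ?B * exp (real j * Im ?\<zeta>)"
      unfolding norm_heat_ker by (simp only: mult.assoc) simp
  qed measurable
qed simp

text \<open>For t > 0 the integrand is entire in \<open>\<zeta>\<close>; for t = 0 both integrands
  are 0. This permits a height that depends on x.\<close>

lemma heat_integral_indep:
  assumes "m > 0" "M > 0" "t \<ge> 0"
  shows "heat_integral m j a (x, t) = heat_integral M j a (x, t)"
proof (cases "t = 0")
  case False
  with assms have t: "t > 0" by simp
  let ?F = "\<lambda>\<zeta>. exp_exp \<zeta> * heat_ker j a (\<zeta> + \<i> * of_real x) t"
  have h: "?F holomorphic_on UNIV"
    unfolding heat_ker_def using t by (intro holomorphic_intros) auto
  have c: "continuous_on S ?F" for S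
    using holomorphic_on_imp_continuous_on[OF h] continuous_on_subset by blast
  have "gamma_integrable N ?F \<and> gamma_integral N ?F = heat_integral N j a (x, t)" if "N > 0" for N
    using gamma_integral_line[OF that c integrable_heat_integral[OF that assms(3)]] by (simp add: heat_integral_def)
  with gamma_integral_entire[OF h assms(1,2)] assms show ?thesis by simp
qed (simp add: heat_integral_def)

text \<open>Differentiability is local, so x may be confined to a bounded interval. For such x a
  single high contour makes all kernels that occur uniformly bounded down to t = 0, apart from
  powers of \<open>\<zeta> + \<i> * x\<close>, and differentiation under the integral is allowed
  there.\<close>

lemma heat_integral_has_derivative:
  assumes M: "M > 0" and a: "a \<le> 0" and p: "p \<in> UNIV \<times> {0..}"
  shows "(heat_integral M j a has_derivative
     (\<lambda>(h, k). h *\<^sub>R (\<i> * of_nat j * heat_integral M (j - 1) a p + \<i> / 2 * heat_integral M (j + 1) (a - 1) p) +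
               k *\<^sub>R (of_real a * heat_integral M j (a - 1) p + (- 1 / 4) * heat_integral M (j + 2) (a - 2) p))) (at p within UNIV \<times> {0..})"
proof -
  obtain x0 t0 where p_eq: "p = (x0, t0)" and t0: "t0 \<ge> 0" using p by auto
  define R where "R = \<bar>x0\<bar> + 1"
  \<comment> \<open>contour high enough to make the kernel small for all \<open>x\<close> with \<open>\<bar>x\<bar> < R\<close>\<close>
  define N where "N = R + 2"
  define S where "S = {- R<..<R} \<times> {0::real..}"
  have N: "N > 0" "N \<ge> 2" by (auto simp: N_def R_def)
  have pS: "p \<in> S" using t0 by (auto simp: S_def p_eq R_def)
  have S: "convex S" "S \<subseteq> UNIV \<times> {0..}" by (auto simp: S_def intro!: convex_Times)
  have K1: "pi / (2 * N) \<le> 1"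
    using N pi_less_4 by (simp add: divide_le_eq)
  \<comment> \<open>The bound is 1 - 4: at this height \<open>Re \<zeta>\<close> has modulus at most
    1, and \<open>Im \<zeta> + x \<ge> N - R = 2\<close>.\<close>
  have neg: "Re ((\<zeta> + \<i> * of_real x)\<^sup>2) \<le> - 3" if "N \<le> Im \<zeta>" "\<bar>Re \<zeta>\<bar> \<le> pi / (2 * N)" "(x, t) \<in> S" for \<zeta> x t
  proof -
    have "(Re \<zeta>)\<^sup>2 \<le> 1\<^sup>2" using that K1 by (intro power2_le_iff_abs_le[THEN iffD2]) auto
    moreover have "2\<^sup>2 \<le> (Im \<zeta> + x)\<^sup>2" using that by (intro power_mono) (auto simp: S_def N_def)
    ultimately show ?thesis unfolding Re_shift_square by simp
  qed
  let ?e = "\<lambda>s. exp_exp (gpath N s) * gder N s"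
  let ?k = "\<lambda>j a p s. heat_ker j a (gpath N s + \<i> * of_real (fst p)) (snd p)"
  let ?a = "\<lambda>p s. ?e s * (\<i> * of_nat j * ?k (j - 1) a p s + \<i> / 2 * ?k (j + 1) (a - 1) p s)"
  let ?b = "\<lambda>p s. ?e s * (of_real a * ?k j (a - 1) p s - 1 / 4 * ?k (j + 2) (a - 2) p s)"
  let ?B = "\<lambda>C j s. C * exp (real j * (pi / (2 * N) + R)) * (norm (exp_exp (gpath N s) * gder N s) * exp (real j * Im (gpath N s)))"
  have bound: "\<exists>C\<ge>0. \<forall>p\<in>S. \<forall>s. norm (?e s * ?k j a p s) \<le> ?B C j s" if a: "a \<le> 0" for j and a :: real
  proof -
    obtain C where C: "C \<ge> 0"
    "(\<forall>j z t. t \<ge> 0 \<longrightarrow> Re (z\<^sup>2) \<le> - 3 \<longrightarrow> norm (heat_ker j a z t) \<le> C * norm z ^ j)"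
    "(\<forall>j z t. 0 \<le> t \<longrightarrow> t \<le> 1 \<longrightarrow> Re (z\<^sup>2) \<le> - 3 \<longrightarrow> norm (heat_ker j a z t) \<le> C * t\<^sup>2 * norm z ^ j)"
    using heat_ker_bound[OF a] by metis
    have "norm (?e s * ?k j a p s) \<le> ?B C j s" if "p \<in> S" for p s
    proof -
      have "norm (?k j a p s) \<le> C * norm (gpath N s + \<i> * of_real (fst p)) ^ j"
        using that neg[OF Im_gpath Re_gpath[OF N(1)], of "fst p" "snd p" s] by (intro C(2)[rule_format]) (auto simp: S_def)
      also have "\<dots> \<le> C * (exp (real j * (pi / (2 * N) + R)) * exp (real j * Im (gpath N s)))"
        using that C(1) Im_gpath[of N s] Re_gpath[OF N(1)] N
        by (intro mult_left_mono norm_shift_power_le) (auto simp: S_def)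
      finally have "norm (?e s) * norm (?k j a p s) \<le> norm (?e s) * (C * (exp (real j * (pi / (2 * N) + R)) * exp (real j * Im (gpath N s))))"
        by (intro mult_left_mono) auto
      then show ?thesis by (simp add: norm_mult mult_ac)
    qed
    with C(1) show ?thesis by blast
  qed
  obtain C1 where C1: "\<And>p s. p \<in> S \<Longrightarrow> norm (?e s * ?k (j - 1) a p s) \<le> ?B C1 (j - 1) s" "C1 \<ge> 0" using bound[of a "j - 1"] a by auto
  obtain C2 where C2: "\<And>p s. p \<in> S \<Longrightarrow> norm (?e s * ?k (j + 1) (a - 1) p s) \<le> ?B C2 (j + 1) s" "C2 \<ge> 0" using bound[of "a - 1" "j + 1"] a by auto
  obtain C3 where C3: "\<And>p s. p \<in> S \<Longrightarrow> norm (?e s * ?k j (a - 1) p s) \<le> ?B C3 j s" "C3 \<ge> 0" using bound[of "a - 1" j] a by auto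
  obtain C4 where C4: "\<And>p s. p \<in> S \<Longrightarrow> norm (?e s * ?k (j + 2) (a - 2) p s) \<le> ?B C4 (j + 2) s" "C4 \<ge> 0" using bound[of "a - 2" "j + 2"] a by auto
  define B where "B s = real j * ?B C1 (j - 1) s + ?B C2 (j + 1) s + \<bar>a\<bar> * ?B C3 j s + ?B C4 (j + 2) s" for s
  have pos: "0 \<le> ?B C n s" if "C \<ge> 0" for C n s using that by simp
  have int: "integrable lborel (\<lambda>s. ?e s * ?k j a q s)" if "q \<in> S" for j a q
    using integrable_heat_integral[OF N(1), of "snd q" j a "fst q"] that by (auto simp: S_def mult_ac)
  have "((\<lambda>p. LBINT s. ?e s * ?k j a p s) has_derivative
           (\<lambda>(h, k). h *\<^sub>R (LBINT s. ?a p s) + k *\<^sub>R (LBINT s. ?b p s))) (at p within S)"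
  proof (rule has_derivative_integral_dominated[OF S(1) pS, where B = B])
    fix q s assume q: "q \<in> S"
    obtain x t where q_eq: "q = (x, t)" by (cases q)
    show "((\<lambda>p. ?e s * ?k j a p s) has_derivative (\<lambda>(h, k). h *\<^sub>R ?a q s + k *\<^sub>R ?b q s)) (at q within S)"
      unfolding q_eq
      by (rule has_derivative_eq_rhs[OF has_derivative_mult_right[OF heat_ker_has_derivative[OF a S(2) _ neg[OF Im_gpath Re_gpath[OF N(1)]]]]])
        (use q q_eq in \<open>auto simp: fun_eq_iff scaleR_conv_of_real algebra_simps\<close>)
    have "norm (?a q s) \<le> real j * norm (?e s * ?k (j - 1) a q s) + norm (?e s * ?k (j + 1) (a - 1) q s)"
      by (simp only: distrib_left) (rule order_trans[OF norm_triangle_ineq], auto simp: norm_mult)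
    also have "\<dots> \<le> real j * ?B C1 (j - 1) s + ?B C2 (j + 1) s"
      by (intro add_mono mult_left_mono C1 C2 q) auto
    also have "\<dots> \<le> B s"
      unfolding B_def using pos[OF C3(2), of j s] pos[OF C4(2), of "j + 2" s]
        mult_nonneg_nonneg[OF abs_ge_zero[of a] pos[OF C3(2), of j s]] by linarith
    finally show "norm (?a q s) \<le> B s" .
    have "norm (?b q s) \<le> \<bar>a\<bar> * norm (?e s * ?k j (a - 1) q s) + norm (?e s * ?k (j + 2) (a - 2) q s)"
      by (simp only: right_diff_distrib) (rule order_trans[OF norm_triangle_ineq4], auto simp: norm_mult)
    also have "\<dots> \<le> \<bar>a\<bar> * ?B C3 j s + ?B C4 (j + 2) s"
      by (intro add_mono mult_left_mono C3 C4 q) auto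
    also have "\<dots> \<le> B s"
      unfolding B_def using pos[OF C1(2), of "j - 1" s] pos[OF C2(2), of "j + 1" s]
        mult_nonneg_nonneg[OF of_nat_0_le_iff[of j] pos[OF C1(2), of "j - 1" s]] by linarith
    finally show "norm (?b q s) \<le> B s" .
  next
    show "integrable lborel (\<lambda>s. ?e s * ?k j a q s)" if "q \<in> S" for q by (rule int[OF that])
    have "?a p = (\<lambda>s. \<i> * of_nat j * (?e s * ?k (j - 1) a p s) + \<i> / 2 * (?e s * ?k (j + 1) (a - 1) p s))"
      by (simp add: fun_eq_iff algebra_simps)
    then show "integrable lborel (?a p)" using int[OF pS] by (simp only:) (intro Bochner_Integration.integrable_add integrable_mult_right, auto)
    have "?b p = (\<lambda>s. of_real a * (?e s * ?k j (a - 1) p s) - 1 / 4 * (?e s * ?k (j + 2) (a - 2) p s))"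
      by (simp add: fun_eq_iff algebra_simps)
    then show "integrable lborel (?b p)" using int[OF pS] by (simp only:) (intro Bochner_Integration.integrable_diff integrable_mult_right, auto)
    show "integrable lborel B"
      unfolding B_def
      by (intro Bochner_Integration.integrable_add integrable_mult_right integrable_exp_exp_gpath[OF N(1)])
  qed
  also have "(LBINT s. ?a p s) = \<i> * of_nat j * heat_integral N (j - 1) a p + \<i> / 2 * heat_integral N (j + 1) (a - 1) p"
  proof -
    have "(LBINT s. ?a p s) = (LBINT s. \<i> * of_nat j * (?e s * ?k (j - 1) a p s) + \<i> / 2 * (?e s * ?k (j + 1) (a - 1) p s))"
      by (intro Bochner_Integration.integral_cong) (auto simp: algebra_simps)
    also have "\<dots> = \<i> * of_nat j * (LBINT s. ?e s * ?k (j - 1) a p s) + \<i> / 2 * (LBINT s. ?e s * ?k (j + 1) (a - 1) p s)"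
      using int[OF pS] by (subst Bochner_Integration.integral_add) (auto intro!: integrable_mult_right)
    finally show ?thesis unfolding heat_integral_def by (simp add: mult_ac)
  qed
  also have "(LBINT s. ?b p s) = of_real a * heat_integral N j (a - 1) p + (- 1 / 4) * heat_integral N (j + 2) (a - 2) p"
  proof -
    have "(LBINT s. ?b p s) = (LBINT s. of_real a * (?e s * ?k j (a - 1) p s) - 1 / 4 * (?e s * ?k (j + 2) (a - 2) p s))"
      by (intro Bochner_Integration.integral_cong) (auto simp: algebra_simps)
    also have "\<dots> = of_real a * (LBINT s. ?e s * ?k j (a - 1) p s) - 1 / 4 * (LBINT s. ?e s * ?k (j + 2) (a - 2) p s)"
      using int[OF pS] by (subst Bochner_Integration.integral_diff) (auto intro!: integrable_mult_right)
    finally show ?thesis unfolding heat_integral_def by (simp add: mult_ac)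
  qed
  finally have *: "((\<lambda>p. LBINT s. ?e s * ?k j a p s) has_derivative
     (\<lambda>(h, k). h *\<^sub>R (\<i> * of_nat j * heat_integral N (j - 1) a p + \<i> / 2 * heat_integral N (j + 1) (a - 1) p) +
               k *\<^sub>R (of_real a * heat_integral N j (a - 1) p + (- 1 / 4) * heat_integral N (j + 2) (a - 2) p))) (at p within S)" .
  \<comment> \<open>On the closed half-plane every height gives the same integrals, so the formula
    at height \<open>N\<close> carries over to \<open>M\<close>.\<close>
  have eq: "heat_integral N j a q = heat_integral M j a q" if "q \<in> UNIV \<times> {0..}" for j a q
    using heat_integral_indep[OF N(1) M, of "snd q" j a "fst q"] that by auto
  have "(heat_integral M j a has_derivative
     (\<lambda>(h, k). h *\<^sub>R (\<i> * of_nat j * heat_integral M (j - 1) a p + \<i> / 2 * heat_integral M (j + 1) (a - 1) p) +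
               k *\<^sub>R (of_real a * heat_integral M j (a - 1) p + (- 1 / 4) * heat_integral M (j + 2) (a - 2) p))) (at p within S)"
  proof (rule has_derivative_transform[OF pS _ *[unfolded eq[OF p]]])
    show "heat_integral M j a q = (LBINT s. ?e s * ?k j a q s)" if "q \<in> S" for q
      using eq[of q j a] that S(2) unfolding heat_integral_def by (auto simp: mult_ac)
  qed
  moreover have "at p within S = at p within UNIV \<times> {0..}"
    by (rule at_within_nhd[of p "{- R<..<R} \<times> UNIV"])
      (use pS in \<open>auto simp: S_def open_Times\<close>)
  ultimately show ?thesis by simp
qed

text \<open>Both partial derivatives are linear combinations of members of the same family, with
  \<open>a\<close> only decreasing; hence the induction over all \<open>j\<close> and all
  \<open>a \<le> 0\<close>.\<close>

lemma Ck_on_heat_integral: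
  assumes M: "M > 0"
  shows "a \<le> 0 \<Longrightarrow> Ck_on k (UNIV \<times> {0..}) (heat_integral M j a)"
proof (induction k arbitrary: j a)
  case 0
  show ?case
    using has_derivative_continuous_on[OF heat_integral_has_derivative[OF M 0]] by auto
next
  case (Suc k)
  have "Ck_on k (UNIV \<times> {0..}) (\<lambda>p. \<i> * of_nat j * heat_integral M (j - 1) a p + \<i> / 2 * heat_integral M (j + 1) (a - 1) p)"
    "Ck_on k (UNIV \<times> {0..}) (\<lambda>p. of_real a * heat_integral M j (a - 1) p + (- 1 / 4) * heat_integral M (j + 2) (a - 2) p)"
    using Suc.prems by (intro Ck_on_add Ck_on_cmult Suc.IH; simp)+
  with heat_integral_has_derivative[OF M Suc.prems] show ?case
    unfolding Ck_on.simps by blast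
qed

lemma heat_integral_partial_x:
  assumes "M > 0" "a \<le> 0" "t \<ge> 0"
  shows "((\<lambda>x. heat_integral M j a (x, t)) has_vector_derivative
     (\<i> * of_nat j * heat_integral M (j - 1) a (x, t) + \<i> / 2 * heat_integral M (j + 1) (a - 1) (x, t))) (at x)"
proof -
  have "((\<lambda>x. (x, t)) has_derivative (\<lambda>h. (h, 0))) (at x within UNIV)"
    by (auto intro!: derivative_eq_intros)
  from has_derivative_in_compose[OF this has_derivative_subset[OF heat_integral_has_derivative[OF assms(1,2)]]] assms(3)
  show ?thesis unfolding has_vector_derivative_def by (auto simp: image_subset_iff)
qed

lemma heat_integral_partial_t:
  assumes "M > 0" "a \<le> 0" "t \<ge> 0"
  shows "((\<lambda>t. heat_integral M j a (x, t)) has_vector_derivative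
     (of_real a * heat_integral M j (a - 1) (x, t) + (- 1 / 4) * heat_integral M (j + 2) (a - 2) (x, t))) (at t within {0..})"
proof -
  have "((\<lambda>t. (x, t)) has_derivative (\<lambda>h. (0, h))) (at t within {0..})"
    by (auto intro!: derivative_eq_intros)
  from has_derivative_in_compose[OF this has_derivative_subset[OF heat_integral_has_derivative[OF assms(1,2)]]] assms(3)
  show ?thesis unfolding has_vector_derivative_def by (auto simp: image_subset_iff)
qed

text \<open>The exponent -1/2 is the one for which the heat equation holds: the time derivative and
  the second space derivative both reduce to -1/2 times the integral with (j, a) = (0, -3/2) minus
  1/4 times the one with (2, -5/2). The initial value is 0 because the kernel is.\<close>

lemma nulltemperature_heat_integral:
  assumes M: "M > 0" and H: "\<And>x t. t \<ge> 0 \<Longrightarrow> H x t = c * heat_integral M 0 (- 1 / 2) (x, t)"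
  shows "nulltemperature H"
  unfolding nulltemperature_def
proof (intro conjI allI impI)
  show "smooth_on (UNIV \<times> {0..}) (\<lambda>(x, t). H x t)"
    unfolding smooth_on_def
  proof
    fix k
    have "Ck_on k (UNIV \<times> {0..}) (\<lambda>p. c * heat_integral M 0 (- 1 / 2) p)"
      by (intro Ck_on_cmult Ck_on_heat_integral M) simp
    then show "Ck_on k (UNIV \<times> {0..}) (\<lambda>(x, t). H x t)"
      by (rule Ck_on_cong) (auto simp: H)
  qed
next
  fix x t :: real assume t: "t \<ge> 0"
  have "((\<lambda>s. c * heat_integral M 0 (- 1 / 2) (x, s)) has_vector_derivative
     c * (of_real (- 1 / 2) * heat_integral M 0 (- 1 / 2 - 1) (x, t) + (- 1 / 4) * heat_integral M 2 (- 1 / 2 - 2) (x, t))) (at t within {0..})"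
    using heat_integral_partial_t[OF M _ t, of "- 1 / 2" 0 x] by (intro has_vector_derivative_mult_right) (auto simp: numeral_2_eq_2)
  then have "((\<lambda>s. H x s) has_vector_derivative
     c * (of_real (- 1 / 2) * heat_integral M 0 (- 1 / 2 - 1) (x, t) + (- 1 / 4) * heat_integral M 2 (- 1 / 2 - 2) (x, t))) (at t within {0..})"
    by (rule has_vector_derivative_transform[rotated 2]) (use t H in auto)
  then have 1: "vector_derivative (\<lambda>s. H x s) (at t within {0..}) = 
     c * (of_real (- 1 / 2) * heat_integral M 0 (- 1 / 2 - 1) (x, t) + (- 1 / 4) * heat_integral M 2 (- 1 / 2 - 2) (x, t))"
  proof (rule vector_derivative_within[rotated])
    have "at t within {t<..} \<le> at t within {0..}"
      using t by (intro at_le) auto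
    then show "at t within {0..} \<noteq> bot"
      using trivial_limit_at_right_real[of t] bot.extremum_uniqueI by metis
  qed
  have "((\<lambda>z. c * heat_integral M 0 (- 1 / 2) (z, t)) has_vector_derivative c * (\<i> / 2 * heat_integral M 1 (- 1 / 2 - 1) (y, t))) (at y)" for y
    using heat_integral_partial_x[OF M _ t, of "- 1 / 2" 0 y] by (intro has_vector_derivative_mult_right) auto
  then have "vector_derivative (\<lambda>z. H z t) (at y) = c * (\<i> / 2 * heat_integral M 1 (- 1 / 2 - 1) (y, t))" for y
    by (intro vector_derivative_at) (use t H in simp)
  moreover have "((\<lambda>y. c * (\<i> / 2 * heat_integral M 1 (- 1 / 2 - 1) (y, t))) has_vector_derivative
      c * (\<i> / 2 * (\<i> * of_nat 1 * heat_integral M (1 - 1) (- 1 / 2 - 1) (x, t) + \<i> / 2 * heat_integral M (1 + 1) (- 1 / 2 - 1 - 1) (x, t)))) (at x)"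
    by (intro has_vector_derivative_mult_right heat_integral_partial_x M t) simp
  ultimately have "vector_derivative (\<lambda>y. vector_derivative (\<lambda>z. H z t) (at y)) (at x) =
      c * (\<i> / 2 * (\<i> * of_nat 1 * heat_integral M (1 - 1) (- 1 / 2 - 1) (x, t) + \<i> / 2 * heat_integral M (1 + 1) (- 1 / 2 - 1 - 1) (x, t)))"
    by (simp only: vector_derivative_at)
  also have "\<dots> = c * (of_real (- 1 / 2) * heat_integral M 0 (- 1 / 2 - 1) (x, t) + (- 1 / 4) * heat_integral M 2 (- 1 / 2 - 2) (x, t))"
    by (simp add: algebra_simps numeral_2_eq_2)
  finally show "vector_derivative (\<lambda>s. H x s) (at t within {0..}) =
      vector_derivative (\<lambda>y. vector_derivative (\<lambda>z. H z t) (at y)) (at x)"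
    using 1 by simp
next
  fix x show "H x 0 = 0" by (simp add: H heat_integral_def)
qed

subsection \<open>The temperature as a contour integral\<close>

lemma exp_power2_shift:
  "exp ((\<zeta> + \<i> * of_real x)\<^sup>2) = exp (\<zeta>\<^sup>2) * exp (2 * \<i> * \<zeta> * of_real x) * of_real (exp (- x\<^sup>2))"
proof -
  have "(\<zeta> + \<i> * of_real x)\<^sup>2 = \<zeta>\<^sup>2 + 2 * \<i> * \<zeta> * of_real x + of_real (- x\<^sup>2)"
    by (simp add: power2_eq_square algebra_simps)
  then show ?thesis by (simp only: exp_add exp_of_real)
qed

lemma integrable_f_integrand:
  assumes M: "M > 0"
  shows "integrable lborel (\<lambda>s. f_integrand l (gpath M s) * gder M s)"
proof -
  have "integrable lborel (\<lambda>s. exp_exp (gpath M s) * exp (gpath M s * of_real l) * gder M s)"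
  proof (rule integrable_exp_exp_gpath_mult[OF M, where n = 0 and B = "exp (pi / (2 * M) * \<bar>l\<bar>)"])
    fix s
    have "Re (gpath M s) * l \<le> \<bar>Re (gpath M s)\<bar> * \<bar>l\<bar>"
      by (metis abs_ge_self abs_mult)
    also have "\<dots> \<le> pi / (2 * M) * \<bar>l\<bar>"
      by (intro mult_right_mono Re_gpath M) auto
    finally show "norm (exp (gpath M s * of_real l)) \<le> exp (pi / (2 * M) * \<bar>l\<bar>) * exp (real 0 * Im (gpath M s))"
      by simp
  qed measurable
  then show ?thesis by (simp add: f_integrand_def exp_exp_def)
qed

lemma gamma_f_integrand:
  assumes M: "M > 0"
  shows "gamma_integrable M (f_integrand l)"
    and "f_fun M l = 1 / (2 * of_real pi * \<i>) * (LBINT s. f_integrand l (gpath M s) * gder M s)"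
proof -
  have "continuous_on (closed_segment (right_branch M) (left_branch M)) (f_integrand l)"
    unfolding f_integrand_def by (intro continuous_intros)
  note gamma_integral_line[OF M this integrable_f_integrand[OF M]]
  then show "gamma_integrable M (f_integrand l)"
    and "f_fun M l = 1 / (2 * of_real pi * \<i>) * (LBINT s. f_integrand l (gpath M s) * gder M s)"
    by (auto simp: f_fun_def)
qed

text \<open>Half of the Gaussian absorbs the linear exponent by completing the square.\<close>

lemma integrable_gauss_exp_abs:
  assumes t: "t > 0"
  shows "integrable lborel (\<lambda>l::real. exp (- t * l\<^sup>2 + K * \<bar>l\<bar>))"
proof (rule Bochner_Integration.integrable_bound[OF integrable_mult_right[OF integrable_gauss[of "t / 2"], of "exp (K\<^sup>2 / (2 * t))"]])
  have "- t * l\<^sup>2 + K * \<bar>l\<bar> \<le> K\<^sup>2 / (2 * t) + - (t / 2) * l\<^sup>2" for l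
  proof -
    have "0 \<le> t / 2 * (\<bar>l\<bar> - K / t)\<^sup>2" using t by simp
    also have "\<dots> = t / 2 * l\<^sup>2 - K * \<bar>l\<bar> + K\<^sup>2 / (2 * t)"
      using t by (simp add: power2_diff power_divide) (simp add: field_simps power2_eq_square)
    finally show ?thesis by (simp add: field_simps)
  qed
  then show "AE l in lborel. norm (exp (- t * l\<^sup>2 + K * \<bar>l\<bar>)) \<le> norm (exp (K\<^sup>2 / (2 * t)) * exp (- (t / 2) * l\<^sup>2))"
    by (intro AE_I2) (simp add: exp_add[symmetric])
qed (use t in auto)

text \<open>Since \<open>Re \<zeta>\<close> is bounded by \<open>pi / (2 * M)\<close> on the
  contour, \<open>K l s\<close> has a majorant in \<open>l\<close> alone and the integrals may be
  interchanged. The inner integral is then Gaussian with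
  \<open>z = \<zeta> + \<i> * x\<close>.\<close>

lemma H_integral:
  assumes M: "M > 0" and t: "t > 0"
  shows "integrable lborel (H_integrand M x t)"
    and "(LBINT l. H_integrand M x t l) = of_real (sqrt pi) / (2 * of_real pi * \<i>) * heat_integral M 0 (- 1 / 2) (x, t)"
proof -
  let ?c = "1 / (2 * of_real pi * \<i>) :: complex"
  define \<phi> where "\<phi> s = exp_exp (gpath M s) * gder M s" for s
  define K where "K l s = exp (- of_real (t * l\<^sup>2) + (gpath M s + \<i> * of_real x) * of_real l)" for l s
  have eq: "H_integrand M x t l = ?c * (LBINT s. \<phi> s * K l s)" for l
  proof -
    let ?d = "of_real (exp (- t * l\<^sup>2)) * exp (\<i> * of_real x * of_real l) :: complex"
    have "\<phi> s * K l s = ?d * (f_integrand l (gpath M s) * gder M s)" for s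
      by (simp add: \<phi>_def K_def f_integrand_def exp_exp_def exp_add[symmetric] exp_of_real[symmetric] ring_distribs del: exp_of_real)
        (simp add: exp_add exp_minus exp_diff field_simps)
    then have "(LBINT s. \<phi> s * K l s) = ?d * (LBINT s. f_integrand l (gpath M s) * gder M s)"
      by simp
    then show ?thesis by (simp add: H_integrand_def gamma_f_integrand[OF M])
  qed
  have \<phi>: "integrable lborel \<phi>"
    using integrable_exp_exp_gpath_mult[OF M, of "\<lambda>_. 1" 1 0] by (simp add: \<phi>_def[abs_def])
  have [measurable]: "case_prod K \<in> borel_measurable (borel \<Otimes>\<^sub>M borel)"
    unfolding K_def by measurable
  have bd: "norm (K l s) \<le> exp (- t * l\<^sup>2 + pi / (2 * M) * \<bar>l\<bar>)" for l s
  proof -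
    have "Re (gpath M s) * l \<le> \<bar>Re (gpath M s)\<bar> * \<bar>l\<bar>"
      by (metis abs_ge_self abs_mult)
    also have "\<dots> \<le> pi / (2 * M) * \<bar>l\<bar>"
      by (intro mult_right_mono Re_gpath M) auto
    finally show ?thesis by (simp add: K_def del: of_real_mult)
  qed
  note F = Fubini_dominated[OF \<phi> integrable_gauss_exp_abs[OF t, of "pi / (2 * M)"] _ bd]
  show "integrable lborel (H_integrand M x t)"
    unfolding eq[abs_def] using F(1) by (intro integrable_mult_right) auto
  have "(LBINT l. H_integrand M x t l) = ?c * (LBINT l. LBINT s. \<phi> s * K l s)"
    unfolding eq by simp
  also have "(LBINT l. LBINT s. \<phi> s * K l s) = (LBINT s. \<phi> s * (LBINT l. K l s))"
    by (rule F(2)) measurable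
  also have "\<dots> = (LBINT s. of_real (sqrt pi) * (exp_exp (gpath M s) * heat_ker 0 (- 1 / 2) (gpath M s + \<i> * of_real x) t * gder M s))"
    unfolding K_def integral_complex_gauss[OF t]
    by (simp add: \<phi>_def heat_ker_def mult_ac)
  also have "\<dots> = of_real (sqrt pi) * heat_integral M 0 (- 1 / 2) (x, t)"
    by (simp add: heat_integral_def)
  finally show "(LBINT l. H_integrand M x t l) = of_real (sqrt pi) / (2 * of_real pi * \<i>) * heat_integral M 0 (- 1 / 2) (x, t)"
    by simp
qed

lemma H_fun_eq_heat_integral:
  assumes M: "M > 0" and t: "t \<ge> 0"
  shows "H_fun M x t = of_real (sqrt pi) / (2 * of_real pi * \<i>) * heat_integral M 0 (- 1 / 2) (x, t)"
proof (cases "t = 0")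
  case False
  with t H_integral(2)[OF M, of t x] show ?thesis by (simp add: H_fun_def)
next
  case True
  let ?c = "of_real (sqrt pi) / (2 * of_real pi * \<i>) :: complex"
  \<comment> \<open>At t = 0 the temperature is defined as a limit; the right-hand side is
    continuous up to the boundary, so that limit exists and has the expected value.\<close>
  have "continuous (at 0 within {0..}) (\<lambda>t. heat_integral M 0 (- 1 / 2) (x, t))"
    using heat_integral_partial_t[OF M, of "- 1 / 2" 0 0 x] by (intro has_vector_derivative_continuous) auto
  then have "((\<lambda>t. heat_integral M 0 (- 1 / 2) (x, t)) \<longlongrightarrow> heat_integral M 0 (- 1 / 2) (x, 0)) (at_right 0)"
    unfolding continuous_within by (rule tendsto_within_subset) auto
  then have "((\<lambda>t. ?c * heat_integral M 0 (- 1 / 2) (x, t)) \<longlongrightarrow> ?c * heat_integral M 0 (- 1 / 2) (x, 0)) (at_right 0)"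
    by (intro tendsto_intros)
  moreover have "\<forall>\<^sub>F t in at_right 0. (LBINT l. H_integrand M x t l) = ?c * heat_integral M 0 (- 1 / 2) (x, t)"
    by (auto simp: eventually_at_filter H_integral(2)[OF M])
  ultimately have "((\<lambda>t. LBINT l. H_integrand M x t l) \<longlongrightarrow> ?c * heat_integral M 0 (- 1 / 2) (x, 0)) (at_right 0)"
    by (rule tendsto_cong[THEN iffD2, rotated])
  then have "Lim (at_right 0) (\<lambda>t. LBINT l. H_integrand M x t l) = ?c * heat_integral M 0 (- 1 / 2) (x, 0)"
    by (intro tendsto_Lim) auto
  with True show ?thesis by (simp add: H_fun_def)
qed

subsection \<open>A residue computation\<close>

lemma segment_branches:
  assumes "z \<in> closed_segment (right_branch M) (left_branch M)"
  shows "Im z = M"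
proof -
  from assms have "z \<in> path_image (linepath (right_branch M) (left_branch M))" by simp
  then show ?thesis unfolding path_image_def linepath_branches by auto
qed

text \<open>The factor \<open>k\<close> rotates the branch cut around \<open>w\<close> without
  changing the derivative.\<close>

lemma has_field_derivative_Ln_affine:
  assumes "k \<noteq> 0" "k * (\<zeta> - w) \<notin> \<real>\<^sub>\<le>\<^sub>0"
  shows "((\<lambda>\<zeta>. Ln (k * (\<zeta> - w))) has_field_derivative 1 / (\<zeta> - w)) (at \<zeta>)"
proof -
  have "\<zeta> \<noteq> w" using assms(2) by auto
  then show ?thesis using assms by (auto intro!: derivative_eq_intros simp: field_simps)
qed

text \<open>The quotient is an entire function \<open>G\<close> plus
  \<open>c / (\<zeta> - w)\<close>. The primitive of \<open>G\<close> cancels around the region. For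
  the polar part each side gets a logarithm whose cut avoids it: \<open>k\<close> is 1 on the right,
  \<open>\<i>\<close> at the bottom, \<open>- \<i>\<close> at the top and -1 on the left. The region
  is encircled clockwise, hence the sign.\<close>

lemma gamma_integral_residue:
  assumes F: "F holomorphic_on UNIV" and mM: "0 < m" "m < v" "v < M"
    and int: "gamma_integrable m (\<lambda>\<zeta>. F \<zeta> / (\<zeta> - \<i> * of_real v))"
      "gamma_integrable M (\<lambda>\<zeta>. F \<zeta> / (\<zeta> - \<i> * of_real v))"
  shows "gamma_integral m (\<lambda>\<zeta>. F \<zeta> / (\<zeta> - \<i> * of_real v)) - gamma_integral M (\<lambda>\<zeta>. F \<zeta> / (\<zeta> - \<i> * of_real v))
    = - (2 * of_real pi * \<i>) * F (\<i> * of_real v)"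
proof -
  define w where "w = \<i> * of_real v"
  define c where "c = F w"
  define G where "G \<zeta> = (if \<zeta> = w then deriv F w else (F \<zeta> - F w) / (\<zeta> - w))" for \<zeta>
  let ?F = "\<lambda>\<zeta>. F \<zeta> / (\<zeta> - w)"
  have "G holomorphic_on UNIV"
    unfolding G_def by (rule pole_lemma[OF F]) simp
  then obtain Q where Q: "\<And>z. (Q has_field_derivative G z) (at z)"
    using holomorphic_convex_primitive'[OF convex_UNIV open_UNIV] by auto
  have P: "((\<lambda>\<zeta>. Q \<zeta> + c * Ln (k * (\<zeta> - w))) has_field_derivative ?F \<zeta>) (at \<zeta>)"
    if "k \<noteq> 0" "k * (\<zeta> - w) \<notin> \<real>\<^sub>\<le>\<^sub>0" for k \<zeta>
  proof -
    have "\<zeta> \<noteq> w" using that by auto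
    then have "?F \<zeta> = G \<zeta> + c * (1 / (\<zeta> - w))"
      by (simp add: G_def c_def diff_divide_distrib)
    with DERIV_add[OF Q DERIV_cmult[OF has_field_derivative_Ln_affine[OF that]]] show ?thesis by simp
  qed
  have cont: "continuous_on S ?F" if "w \<notin> S" for S
    using that holomorphic_on_imp_continuous_on[OF F]
    by (intro continuous_intros) (auto intro: continuous_on_subset)
  have Re_r: "Re (right_branch \<tau>) > 0" and Re_l: "Re (left_branch \<tau>) < 0" if "\<tau> > 0" for \<tau>
    using that by (auto simp: right_branch_def left_branch_def)
  have nonpos: "z \<notin> \<real>\<^sub>\<le>\<^sub>0" if "Re z > 0" for z :: complex
    using that by (auto simp: complex_nonpos_Reals_iff)
  define A where "A = right_branch M - w"
  define B where "B = right_branch m - w"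
  define C where "C = left_branch m - w"
  define D where "D = left_branch M - w"
  have ABCD: "Re A > 0" "Im A > 0" "Re B > 0" "Im B < 0" "Re C < 0" "Im C < 0" "Re D < 0" "Im D > 0"
    using mM by (auto simp: A_def B_def C_def D_def w_def right_branch_def left_branch_def)
  then have nz: "A \<noteq> 0" "B \<noteq> 0" "C \<noteq> 0" "D \<noteq> 0" by auto
  have "gamma_integral m ?F - gamma_integral M ?F =
    - ((Q (right_branch M) + c * Ln (1 * A)) - (Q (right_branch m) + c * Ln (1 * B)))
    + ((Q (left_branch m) + c * Ln (\<i> * C)) - (Q (right_branch m) + c * Ln (\<i> * B)))
    - ((Q (left_branch M) + c * Ln (- \<i> * D)) - (Q (right_branch M) + c * Ln (- \<i> * A)))
    + ((Q (left_branch M) + c * Ln (- 1 * D)) - (Q (left_branch m) + c * Ln (- 1 * C)))"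
    unfolding A_def B_def C_def D_def
  proof (rule gamma_integral_diff)
    show "gamma_integrable m ?F" "gamma_integrable M ?F" using int by (simp_all add: w_def)
    show "0 < m" "m \<le> M" using mM by auto
    show "continuous_on (right_branch ` {m..M}) ?F"
    proof (rule cont)
      have "Re w \<noteq> Re (right_branch \<tau>)" if "\<tau> \<in> {m..M}" for \<tau>
        using Re_r[of \<tau>] that mM by (simp add: w_def)
      then show "w \<notin> right_branch ` {m..M}" by blast
    qed
    show "continuous_on (left_branch ` {m..M}) ?F"
    proof (rule cont)
      have "Re w \<noteq> Re (left_branch \<tau>)" if "\<tau> \<in> {m..M}" for \<tau>
        using Re_l[of \<tau>] that mM by (simp add: w_def)
      then show "w \<notin> left_branch ` {m..M}" by blast
    qed
    show "((\<lambda>\<zeta>. Q \<zeta> + c * Ln (1 * (\<zeta> - w))) has_field_derivative ?F (right_branch \<tau>)) (at (right_branch \<tau>))"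
      if "\<tau> \<in> {m..M}" for \<tau>
      by (intro P nonpos) (use that mM Re_r[of \<tau>] in \<open>auto simp: w_def\<close>)
    show "((\<lambda>\<zeta>. Q \<zeta> + c * Ln (- 1 * (\<zeta> - w))) has_field_derivative ?F (left_branch \<tau>)) (at (left_branch \<tau>))"
      if "\<tau> \<in> {m..M}" for \<tau>
      by (intro P nonpos) (use that mM Re_l[of \<tau>] in \<open>auto simp: w_def\<close>)
    show "((\<lambda>\<zeta>. Q \<zeta> + c * Ln (\<i> * (\<zeta> - w))) has_field_derivative ?F z) (at z)"
      if "z \<in> closed_segment (right_branch m) (left_branch m)" for z
      by (intro P nonpos) (use segment_branches[OF that] mM in \<open>auto simp: w_def\<close>)
    show "((\<lambda>\<zeta>. Q \<zeta> + c * Ln (- \<i> * (\<zeta> - w))) has_field_derivative ?F z) (at z)"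
      if "z \<in> closed_segment (right_branch M) (left_branch M)" for z
      by (intro P nonpos) (use segment_branches[OF that] mM in \<open>auto simp: w_def\<close>)
  qed
  \<comment> \<open>The corners lie in the four quadrants around \<open>w\<close>. At each of them
    the logarithms of the two adjacent sides differ by a quarter turn, which adds up to
    \<open>2 * pi * \<i>\<close>.\<close>
  moreover have "Ln A = Ln (- \<i> * A) + \<i> * of_real pi / 2"
    using Ln_times_ii[of "- \<i> * A"] ABCD nz by auto
  moreover have "Ln (\<i> * B) = Ln B + \<i> * of_real pi / 2"
    using Ln_times_ii[of B] ABCD nz by auto
  moreover have "Ln (- 1 * C) = Ln (\<i> * C) + \<i> * of_real pi / 2"
    using Ln_times_ii[of "\<i> * C"] ABCD nz by auto
  moreover have "Ln (- \<i> * D) = Ln (- 1 * D) + \<i> * of_real pi / 2"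
    using Ln_times_ii[of "- 1 * D"] ABCD nz by auto
  ultimately have "gamma_integral m ?F - gamma_integral M ?F = - (2 * of_real pi * \<i>) * c"
    by (simp only: mult_1_left) (simp add: algebra_simps)
  then show ?thesis by (simp add: w_def c_def)
qed

text \<open>With \<open>c = 2 * \<i> * (\<zeta> - \<i> * v)\<close>, whose real part is negative
  when \<open>Im \<zeta> > v\<close>, this writes the Cauchy kernel as a superposition of Fourier
  kernels.\<close>

lemma integral_exp_halfline:
  fixes c :: complex
  assumes c: "Re c < 0"
  shows "integrable lborel (\<lambda>x. indicator {0<..} x *\<^sub>R exp (c * of_real x))"
    and "(LBINT x. indicator {0<..} x *\<^sub>R exp (c * of_real x)) = - (1 / c)"
proof -
  define a where "a = - Re c"
  have a: "a > 0" and c0: "c \<noteq> 0" using c by (auto simp: a_def)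
  have "((\<lambda>x. exp (- a * x)) has_integral exp (- a * 0) / a) {0..}"
    by (rule has_integral_exp_minus_to_infinity[OF a])
  then have "set_integrable lebesgue {0..} (\<lambda>x. exp (- a * x))"
    by (intro nonnegative_absolutely_integrable_1) auto
  then have "set_integrable lebesgue {0<..} (\<lambda>x. exp (- a * x))"
    by (rule set_integrable_subset) auto
  then have e: "integrable lborel (\<lambda>x. indicator {0<..} x *\<^sub>R exp (- a * x))"
    unfolding set_integrable_def by (subst (asm) integrable_completion) auto
  show int: "integrable lborel (\<lambda>x. indicator {0<..} x *\<^sub>R exp (c * of_real x))"
    by (rule Bochner_Integration.integrable_bound[OF e]) (auto simp: a_def indicator_def)
  have lim: "((\<lambda>x. exp (c * of_real x) / c) \<longlongrightarrow> 0) at_top"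
  proof -
    have "((\<lambda>x. exp (- (a * x))) \<longlongrightarrow> 0) at_top"
      using a by (intro filterlim_compose[OF exp_at_bot] filterlim_uminus_at_bot_at_top[THEN filterlim_compose] filterlim_tendsto_pos_mult_at_top[OF tendsto_const a filterlim_ident])
    then have "((\<lambda>x. exp (c * of_real x)) \<longlongrightarrow> 0) at_top"
      by (subst tendsto_norm_zero_iff[symmetric]) (simp add: a_def)
    from tendsto_divide_zero[OF this] show ?thesis .
  qed
  have "(LBINT x=ereal 0..\<infinity>. exp (c * of_real x)) = 0 - exp (c * of_real 0) / c"
  proof (rule interval_integral_FTC_integrable[where F = "\<lambda>x. exp (c * of_real x) / c"])
    show "((\<lambda>x. exp (c * of_real x) / c) has_vector_derivative exp (c * of_real x)) (at x)" for x
    proof -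
      have "((\<lambda>z. exp (c * z) / c) has_field_derivative exp (c * of_real x)) (at (of_real x))"
        using c0 by (auto intro!: derivative_eq_intros)
      from has_vector_derivative_real_field[OF this] show ?thesis by (simp add: o_def)
    qed
    show "isCont (\<lambda>x. exp (c * of_real x)) x" for x by (intro continuous_intros)
    show "set_integrable lborel (einterval (ereal 0) \<infinity>) (\<lambda>x. exp (c * of_real x))"
      using int by (simp add: set_integrable_def einterval_def greaterThan_def)
    have "isCont (\<lambda>x. exp (c * of_real x) / c) 0" using c0 by (intro continuous_intros) auto
    then have "((\<lambda>x. exp (c * of_real x) / c) \<longlongrightarrow> exp (c * of_real 0) / c) (at_right 0)"
      by (simp add: isCont_def tendsto_within_subset filterlim_at_split)
    then show "(((\<lambda>x. exp (c * of_real x) / c) \<circ> real_of_ereal) \<longlongrightarrow> exp (c * of_real 0) / c) (at_right (ereal 0))"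
      by (simp add: ereal_tendsto_simps)
    show "(((\<lambda>x. exp (c * of_real x) / c) \<circ> real_of_ereal) \<longlongrightarrow> 0) (at_left \<infinity>)"
      using lim by (simp add: ereal_tendsto_simps)
  qed simp
  then show "(LBINT x. indicator {0<..} x *\<^sub>R exp (c * of_real x)) = - (1 / c)"
    by (simp add: interval_lebesgue_integral_def set_lebesgue_integral_def einterval_def greaterThan_def)
qed

subsection \<open>Non-triviality\<close>

text \<open>Up to height \<open>v + 1\<close> the branches keep horizontal distance
  \<open>pi / (2 * \<tau>)\<close> from the imaginary axis; beyond it, and on the segment at height
  1, the vertical distance is at least 1. The Cauchy kernel therefore costs only a factor linear in
  \<open>v\<close>.\<close>

lemma gpath_1_distance:
  assumes v: "v \<ge> 2"
  shows "1 / (v + 1) \<le> norm (gpath 1 s - \<i> * of_real v)"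
proof -
  let ?z = "gpath 1 s - \<i> * of_real v"
  have le1: "1 / (v + 1) \<le> 1" using v by simp
  have branch: "1 / (v + 1) \<le> norm (Complex b \<tau> - \<i> * of_real v)"
    if "\<tau> \<ge> 1" "\<bar>b\<bar> = pi / (2 * \<tau>)" for b \<tau>
  proof (cases "\<tau> \<le> v + 1")
    case True
    have "1 / (v + 1) = 2 / (2 * (v + 1))" using v by (simp add: field_simps)
    also have "\<dots> \<le> pi / (2 * \<tau>)"
      using that True v pi_ge_two by (intro frac_le) auto
    also have "\<dots> \<le> norm (Complex b \<tau> - \<i> * of_real v)"
      using abs_Re_le_cmod[of "Complex b \<tau> - \<i> * of_real v"] that by simp
    finally show ?thesis .
  next
    case False
    then show ?thesis
      using abs_Im_le_cmod[of "Complex b \<tau> - \<i> * of_real v"] le1 by simp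
  qed
  consider "s \<le> 0" | "0 < s" "s < 1" | "s \<ge> 1" by linarith
  then show ?thesis
  proof cases
    case 1
    then show ?thesis using branch[of "1 - s" "pi / (2 * (1 - s))"]
      by (simp add: gpath_def right_branch_def)
  next
    case 2
    then have "Im ?z = 1 - v" unfolding gpath_def linepath_branches by simp
    with abs_Im_le_cmod[of ?z] v le1 show ?thesis by linarith
  next
    case 3
    then show ?thesis using branch[of s "- pi / (2 * s)"]
      by (simp add: gpath_def left_branch_def)
  qed
qed

text \<open>On the contour at height \<open>v + 1\<close> the exponent in \<open>K\<close> has real
  part at most \<open>- 2 * x\<close>, so the weight \<open>exp (2 * v * x)\<close> is beaten
  uniformly in \<open>s\<close> and the x-integral can be taken first.\<close>

lemma heat_integral_vanishing_imp_Cauchy_vanishing: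
  assumes v: "v > 0" and zero: "\<And>x. heat_integral (v + 1) 0 (- 1 / 2) (x, 1 / 4) = 0"
  shows "(LBINT s. exp_exp (gpath (v + 1) s) * exp ((gpath (v + 1) s)\<^sup>2) / (gpath (v + 1) s - \<i> * of_real v) * gder (v + 1) s) = 0"
proof -
  let ?g = "gpath (v + 1)"
  define \<phi> where "\<phi> s = exp_exp (?g s) * exp ((?g s)\<^sup>2) * gder (v + 1) s" for s
  define K where "K x s = indicator {0<..} x *\<^sub>R exp (2 * \<i> * (?g s - \<i> * of_real v) * of_real x)" for x s
  have \<phi>: "integrable lborel \<phi>"
    unfolding \<phi>_def
  proof (rule integrable_exp_exp_gpath_mult[where n = 0 and B = "exp ((pi / (2 * (v + 1)))\<^sup>2)"])
    fix s
    have "(Re (?g s))\<^sup>2 \<le> (pi / (2 * (v + 1)))\<^sup>2"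
      using power_mono[OF Re_gpath[of "v + 1" s], of 2] v by simp
    then have "Re ((?g s)\<^sup>2) \<le> (pi / (2 * (v + 1)))\<^sup>2"
      using zero_le_power2[of "Im (?g s)"] unfolding Re_power2 by linarith
    then show "norm (exp ((?g s)\<^sup>2)) \<le> exp ((pi / (2 * (v + 1)))\<^sup>2) * exp (real 0 * Im (?g s))"
      by simp
  qed (use v in auto)
  have Re_neg: "Re (2 * \<i> * (?g s - \<i> * of_real v)) \<le> - 2" for s
    using Im_gpath[of "v + 1" s] by simp
  have mono: "integrable lborel (\<lambda>x. indicator {0<..} x *\<^sub>R exp (- 2 * x :: real))"
    using integrable_norm[OF integral_exp_halfline(1)[of "- 2"]] by simp
  have bd: "norm (K x s) \<le> indicator {0<..} x *\<^sub>R exp (- 2 * x)" for x s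
    using mult_right_mono[OF Re_neg[of s], of x] by (auto simp: K_def indicator_def)
  have [measurable]: "case_prod K \<in> borel_measurable (borel \<Otimes>\<^sub>M borel)"
    unfolding K_def by measurable
  have inner: "(LBINT s. \<phi> s * K x s) = 0" for x
  proof -
    \<comment> \<open>at time 1/4 the kernel factors as \<open>exp (\<zeta>\<^sup>2)\<close> times a Fourier kernel times a function of \<open>x\<close>\<close>
    have sq: "(1 / 4 :: real) powr - (1 / 2) = 2"
      by (simp add: powr_minus_divide powr_half_sqrt real_sqrt_divide)
    have "\<phi> s * exp (2 * \<i> * ?g s * of_real x) * (2 * of_real (exp (- x\<^sup>2))) =
        exp_exp (?g s) * heat_ker 0 (- 1 / 2) (?g s + \<i> * of_real x) (1 / 4) * gder (v + 1) s" for s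
      by (simp add: heat_ker_def exp_power2_shift sq \<phi>_def mult_ac)
    then have "(LBINT s. \<phi> s * exp (2 * \<i> * ?g s * of_real x) * (2 * of_real (exp (- x\<^sup>2)))) = 0"
      using zero[of x] by (simp add: heat_integral_def)
    then have "(LBINT s. \<phi> s * exp (2 * \<i> * ?g s * of_real x)) = 0"
      by simp
    moreover have "\<phi> s * K x s = (\<phi> s * exp (2 * \<i> * ?g s * of_real x)) * (indicator {0<..} x *\<^sub>R exp (2 * of_real v * of_real x))" for s
      by (simp add: K_def exp_add[symmetric] algebra_simps)
    ultimately show ?thesis by simp
  qed
  have "(LBINT s. \<phi> s * (LBINT x. K x s)) = (LBINT x. LBINT s. \<phi> s * K x s)"
    by (rule Fubini_dominated(2)[OF \<phi> mono _ bd, symmetric]) measurable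
  also have "\<dots> = 0" by (simp add: inner)
  finally have "(LBINT s. \<phi> s * (LBINT x. K x s)) = 0" .
  moreover have "(LBINT x. K x s) = - (1 / (2 * \<i> * (?g s - \<i> * of_real v)))" for s
    unfolding K_def using Re_neg[of s] by (intro integral_exp_halfline(2)) simp
  moreover have "a * - (1 / (2 * \<i> * q)) = - (1 / (2 * \<i>)) * (a / q)" for a q :: complex
    by (simp only: divide_inverse inverse_mult_distrib mult_1_left mult_minus_left mult_minus_right mult_ac)
  ultimately have "(LBINT s. (- (1 / (2 * \<i>))) * (\<phi> s / (?g s - \<i> * of_real v))) = 0"
    by (simp only:)
  then have "(LBINT s. \<phi> s / (?g s - \<i> * of_real v)) = 0"
    by (subst (asm) integral_mult_right_zero) simp
  then show ?thesis by (simp add: \<phi>_def)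
qed

lemma integrable_Cauchy:
  assumes M: "M > 0" and d: "d > 0" and w: "\<And>s. d \<le> norm (gpath M s - w)"
  shows "integrable lborel (\<lambda>s. exp_exp (gpath M s) * (exp ((gpath M s)\<^sup>2) / (gpath M s - w)) * gder M s)"
proof (rule integrable_exp_exp_gpath_mult[OF M, where n = 0 and B = "exp ((pi / (2 * M))\<^sup>2) / d"])
  fix s
  have "(Re (gpath M s))\<^sup>2 \<le> (pi / (2 * M))\<^sup>2"
    using power_mono[OF Re_gpath[OF M, of s], of 2] by simp
  then have "Re ((gpath M s)\<^sup>2) \<le> (pi / (2 * M))\<^sup>2"
    using zero_le_power2[of "Im (gpath M s)"] unfolding Re_power2 by linarith
  then have "exp (Re ((gpath M s)\<^sup>2)) / norm (gpath M s - w) \<le> exp ((pi / (2 * M))\<^sup>2) / d"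
    using w[of s] d by (intro frac_le) auto
  then show "norm (exp ((gpath M s)\<^sup>2) / (gpath M s - w)) \<le> exp ((pi / (2 * M))\<^sup>2) / d * exp (real 0 * Im (gpath M s))"
    by (simp add: norm_divide del: Re_power2)
qed measurable

lemma heat_integral_not_vanishing:
  assumes M: "M > 0"
  shows "\<exists>x. heat_integral M 0 (- 1 / 2) (x, 1 / 4) \<noteq> 0"
proof (rule ccontr)
  assume "\<nexists>x. heat_integral M 0 (- 1 / 2) (x, 1 / 4) \<noteq> 0"
  then have zero: "heat_integral N 0 (- 1 / 2) (x, 1 / 4) = 0" if "N > 0" for N x
    using heat_integral_indep[OF that M, of "1 / 4" 0 "- 1 / 2" x] by simp
  define F where "F \<zeta> = exp_exp \<zeta> * exp (\<zeta>\<^sup>2)" for \<zeta>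
  define C where "C = (LBINT s. norm (F (gpath 1 s) * gder 1 s))"
  \<comment> \<open>\<open>C\<close> belongs to the fixed contour at height 1, so \<open>v\<close>
    may be chosen after it; this choice bounds \<open>(v + 1) * C\<close> by
    \<open>2 * v\<^sup>2\<close>.\<close>
  define v where "v = C + 2"
  define w where "w = \<i> * of_real v"
  have "C \<ge> 0" unfolding C_def by (intro integral_nonneg_AE) auto
  then have v: "v \<ge> 2" "C \<le> v" by (auto simp: v_def)
  let ?F = "\<lambda>\<zeta>. F \<zeta> / (\<zeta> - w)"
  have F: "F holomorphic_on UNIV" unfolding F_def by (intro holomorphic_intros)
  have line: "gamma_integrable N ?F \<and> gamma_integral N ?F = (LBINT s. ?F (gpath N s) * gder N s)"
    if "N > 0" "N \<noteq> v" "d > 0" "\<And>s. d \<le> norm (gpath N s - w)" for N d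
  proof -
    have "z - w \<noteq> 0" if "z \<in> closed_segment (right_branch N) (left_branch N)" for z
      using segment_branches[OF that] \<open>N \<noteq> v\<close> by (auto simp: w_def complex_eq_iff)
    then have "continuous_on (closed_segment (right_branch N) (left_branch N)) ?F"
      using holomorphic_on_imp_continuous_on[OF F]
      by (intro continuous_intros) (auto intro: continuous_on_subset)
    from gamma_integral_line[OF that(1) this] integrable_Cauchy[OF that(1,3,4)]
    show ?thesis by (simp add: F_def)
  qed
  have dist1: "1 / (v + 1) \<le> norm (gpath 1 s - w)" for s
    unfolding w_def by (rule gpath_1_distance[OF v(1)])
  have distv: "1 \<le> norm (gpath (v + 1) s - w)" for s
    using abs_Im_le_cmod[of "gpath (v + 1) s - w"] Im_gpath[of "v + 1" s] by (simp add: w_def)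
  have 1: "gamma_integrable 1 ?F" "gamma_integral 1 ?F = (LBINT s. ?F (gpath 1 s) * gder 1 s)"
    using line[OF _ _ _ dist1] v by auto
  have 2: "gamma_integrable (v + 1) ?F" "gamma_integral (v + 1) ?F = (LBINT s. ?F (gpath (v + 1) s) * gder (v + 1) s)"
    using line[OF _ _ _ distv] v by auto
  have "gamma_integral (v + 1) ?F = 0"
    using heat_integral_vanishing_imp_Cauchy_vanishing[of v] zero[of "v + 1"] v 2(2) by (simp add: F_def w_def)
  \<comment> \<open>The integral above the pole vanishes, so the integral at height 1 is the residue
    alone.\<close>
  with gamma_integral_residue[OF F, of 1 v "v + 1"] 1(1) 2(1) v
  have res: "gamma_integral 1 ?F = - (2 * of_real pi * \<i>) * F w"
    by (simp add: w_def)
  have "norm (gamma_integral 1 ?F) \<le> (LBINT s. norm (?F (gpath 1 s) * gder 1 s))"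
    unfolding 1(2) by (rule integral_norm_bound)
  also have "\<dots> \<le> (LBINT s. (v + 1) * norm (F (gpath 1 s) * gder 1 s))"
  proof (rule integral_mono)
    have "integrable lborel (\<lambda>s. ?F (gpath 1 s) * gder 1 s)"
      using integrable_Cauchy[of 1 "1 / (v + 1)" w] dist1 v by (simp add: F_def)
    then show "integrable lborel (\<lambda>s. norm (?F (gpath 1 s) * gder 1 s))" by (rule integrable_norm)
    have "integrable lborel (\<lambda>s. exp_exp (gpath 1 s) * exp ((gpath 1 s)\<^sup>2) * gder 1 s)"
    proof (rule integrable_exp_exp_gpath_mult[where n = 0 and B = "exp ((pi / 2)\<^sup>2)"])
      fix s
      have "(Re (gpath 1 s))\<^sup>2 \<le> (pi / 2)\<^sup>2"
        using power_mono[OF Re_gpath[of 1 s], of 2] by simp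
      then have "Re ((gpath 1 s)\<^sup>2) \<le> (pi / 2)\<^sup>2"
        using zero_le_power2[of "Im (gpath 1 s)"] unfolding Re_power2 by linarith
      then show "norm (exp ((gpath 1 s)\<^sup>2)) \<le> exp ((pi / 2)\<^sup>2) * exp (real 0 * Im (gpath 1 s))"
        by (simp del: Re_power2)
    qed auto
    then show "integrable lborel (\<lambda>s. (v + 1) * norm (F (gpath 1 s) * gder 1 s))"
      unfolding F_def by (intro integrable_mult_right integrable_norm) 
    fix s
    have "1 / norm (gpath 1 s - w) \<le> v + 1"
      using dist1[of s] v by (smt (verit) divide_le_eq mult.commute norm_ge_zero zero_less_divide_1_iff)
    from mult_right_mono[OF this, of "norm (F (gpath 1 s) * gder 1 s)"]
    show "norm (?F (gpath 1 s) * gder 1 s) \<le> (v + 1) * norm (F (gpath 1 s) * gder 1 s)"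
      by (simp add: norm_mult norm_divide)
  qed
  also have "\<dots> = (v + 1) * C" by (simp add: C_def)
  also have "\<dots> \<le> (2 * v) * v" using v \<open>C \<ge> 0\<close> by (intro mult_mono) auto
  finally have upper: "2 * pi * norm (F w) \<le> 2 * v\<^sup>2"
    unfolding res by (simp add: norm_mult power2_eq_square)
  define u where "u = v\<^sup>2"
  have u: "u \<ge> 4" using power_mono[OF v(1), of 2] by (simp add: u_def)
  \<comment> \<open>On the imaginary axis \<open>exp (- w\<^sup>2)\<close> is positive, in contrast
    to the branches, and \<open>F w\<close> is doubly exponentially large.\<close>
  have "w\<^sup>2 = - of_real u" by (simp add: w_def u_def power_mult_distrib)
  then have "norm (F w) = exp (exp u - u)"
    by (simp add: F_def exp_exp_def norm_mult norm_inverse exp_diff exp_minus Re_exp divide_inverse)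
  also have "\<dots> \<ge> exp u - u + 1"
    using exp_ge_add_one_self[of "exp u - u"] by linarith
  moreover have "exp u \<ge> 1 + u + u\<^sup>2 / 2"
    using u by (intro exp_lower_Taylor_quadratic) auto
  moreover have "u\<^sup>2 \<ge> 4 * u" using u by (simp add: power2_eq_square)
  ultimately have "norm (F w) > u" using u by linarith
  moreover have "2 * norm (F w) \<le> pi * norm (F w)"
    using pi_ge_two by (intro mult_right_mono) auto
  ultimately show False using upper u by (simp add: u_def)
qed

theorem theorem6p6:
  fixes M :: real
  assumes "M > 0"
  shows "(\<forall>l. gamma_integrable M (f_integrand l)) \<and>
         (\<forall>x. \<forall>t>0. integrable lborel (H_integrand M x t)) \<and>
         nulltemperature (H_fun M) \<and>
         (\<exists>x. \<exists>t\<ge>0. H_fun M x t \<noteq> 0)"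
proof (intro conjI allI impI)
  show "gamma_integrable M (f_integrand l)" for l
    by (rule gamma_f_integrand[OF assms])
  show "integrable lborel (H_integrand M x t)" if "t > 0" for x t
    by (rule H_integral[OF assms that])
  show "nulltemperature (H_fun M)"
    by (rule nulltemperature_heat_integral[OF assms H_fun_eq_heat_integral[OF assms]])
  obtain x where "heat_integral M 0 (- 1 / 2) (x, 1 / 4) \<noteq> 0"
    using heat_integral_not_vanishing[OF assms] by blast
  then have "H_fun M x (1 / 4) \<noteq> 0"
    by (simp add: H_fun_eq_heat_integral[OF assms])
  then show "\<exists>x. \<exists>t\<ge>0. H_fun M x t \<noteq> 0"
    by (intro exI[of _ x] exI[of _ "1 / 4"]) simp
qed

end
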